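(* Let $$A=\begin{pmatrix}3&1&1&0\\1&3&0&1\\1&0&1&0\\0&1&0&1\end{pmatrix},\qquad B=\frac12\begin{pmatrix}1\\-1\\1\\1\end{pmatrix},\qquad C=\frac1{15}.$$ (a) For $q=e^{2\pi iz}$, $\operatorname{Im}z>0$, $$F_{A,B,C}(q)=\frac{\eta(2z)^2\,\theta_{5,1}(z)}{\eta(z)^3}.$$ (b) The solutions $(Q_1,Q_2,Q_3,Q_4)$ in $(\mathbb{C}^* )^4$ of the system $1-Q_i=\prod_{j=1}^4Q_j^{A_{ij}}$, $i=1,\dots,4$, are exactly $$\Bigl(u,u,\tfrac1{1+u},\tfrac1{1+u}\Bigr)\text{ with }1-u^2=u^4\qquad\text{and}\qquad\Bigl(u,-u,\tfrac1{1+u},\tfrac1{1-u}\Bigr)\text{ with }1-u^2=-u^4 .$$ (c) For every solution of the first type the element $[Q_1]+[Q_2]+[Q_3]+[Q_4]$ is torsion in the corresponding Bloch group, while for every solution of the second type it is not torsion.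
   Context: $(q)_n=\prod_{k=1}^n(1-q^k)$, $q^x=e^{2\pi ixz}$, and for a real positive definite symmetric $r\times r$ matrix $A$, $B\in\mathbb{R}^r$, $C\in\mathbb{R}$, $$F_{A,B,C}(q)=\sum_{n\in(\mathbb{Z}_{\ge0})^r}\frac{q^{\frac12n^TAn+n^TB+C}}{(q)_{n_1}\cdots(q)_{n_r}}.$$ $\eta(z)=q^{1/24}\prod_{n\ge1}(1-q^n)$ and $\theta_{5,1}(z)=\sum_{n\equiv1\,(10)}(-1)^{\lfloor n/10\rfloor}q^{n^2/40}$. Bloch group $B(K)$ of a field $K$: the quotient of the kernel of $\mathbb{Z}[K^*\setminus\{1\}]\to\Lambda^2K^*$, $[x]\mapsto x\wedge(1-x)$ (with $\Lambda^2K^*$ taken modulo torsion) by the subgroup generated by all elements $[x]+[1-x]$, $[x]+[1/x]$, and $[x]+[y]+[1-xy]+\bigl[\frac{1-x}{1-xy}\bigr]+\bigl[\frac{1-y}{1-xy}\bigr]$ (with $xy\ne1$). For a solution of the system in a number field $K$, symmetry of $A$ implies that $\sum_i[Q_i]$ lies in this kernel, and "the corresponding Bloch group" is $B(K)$ with $K=\mathbb{Q}(Q_1,\dots,Q_4)$. *)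

theory Defs
  imports
    "HOL-Analysis.Analysis"
    "HOL-Algebra.Free_Abelian_Groups"
    "HOL-Algebra.Generated_Fields"
    "HOL-Algebra.Algebraic_Closure_Type"
begin

section \<open>Nahm sums and modular forms\<close>

text \<open>All functions of \<open>q\<close> are functions of \<open>z\<close> in the upper half plane;
  fractional powers mean \<open>q\<^sup>x = exp (2\<pi>ixz)\<close>.\<close>

definition qpow :: "complex \<Rightarrow> real \<Rightarrow> complex" where
  "qpow z x = exp (2 * of_real pi * \<i> * of_real x * z)"

definition qpoch :: "complex \<Rightarrow> nat \<Rightarrow> complex" where
  "qpoch z n = (\<Prod>k=1..n. 1 - qpow z (real k))"

definition nahm_term ::
  "real^'r^'r \<Rightarrow> real^'r \<Rightarrow> real \<Rightarrow> complex \<Rightarrow> nat^'r \<Rightarrow> complex" where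
  "nahm_term A B C z n =
     (let v = (\<chi> i. real (n $ i)) :: real^'r
      in qpow z ((1/2) * (v \<bullet> (A *v v)) + v \<bullet> B + C) / (\<Prod>i\<in>UNIV. qpoch z (n $ i)))"

definition nahm_sum ::
  "real^'r^'r \<Rightarrow> real^'r \<Rightarrow> real \<Rightarrow> complex \<Rightarrow> complex" where
  "nahm_sum A B C z = (\<Sum>\<^sub>\<infinity>n. nahm_term A B C z n)"

definition dedekind_eta :: "complex \<Rightarrow> complex" where
  "dedekind_eta z = qpow z (1/24) * prodinf (\<lambda>n. 1 - qpow z (real (Suc n)))"

definition theta_5_1 :: "complex \<Rightarrow> complex" where
  "theta_5_1 z =
     (\<Sum>\<^sub>\<infinity>n\<in>{n::int. n mod 10 = 1}. (-1) powi (n div 10) * qpow z ((real_of_int n)\<^sup>2 / 40))"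

definition nahm_system :: "int^'r^'r \<Rightarrow> complex^'r \<Rightarrow> bool" where
  "nahm_system A Q \<longleftrightarrow> (\<forall>i. 1 - Q $ i = (\<Prod>j\<in>UNIV. (Q $ j) powi (A $ i $ j)))"

section \<open>The Bloch group\<close>

text \<open>Throughout, \<open>K\<close> is (the underlying set of) a subfield of an ambient field. The groups
  \<open>\<int>[S]\<close> are written additively as finitely supported functions, but HOL-Algebra treats them
  as multiplicative groups: \<open>[^]\<close> is then the multiplication by a natural number.\<close>

definition torsion_elements :: "('a, 'b) monoid_scheme \<Rightarrow> 'a set" where
  "torsion_elements G = {x \<in> carrier G. \<exists>n::nat. n > 0 \<and> x [^]\<^bsub>G\<^esub> n = \<one>\<^bsub>G\<^esub>}"

text \<open>\<open>\<Lambda>\<^sup>2K\<^sup>*\<close> is the free abelian group on symbols \<open>(x, y)\<close>, standing for \<open>x \<and> y\<close>, modulo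
  bilinearity (over \<open>\<int>\<close>, with \<open>K\<^sup>*\<close> written multiplicatively) and \<open>x \<and> x = 0\<close>.\<close>

definition wedge_free :: "'a::field set \<Rightarrow> ('a \<times> 'a \<Rightarrow>\<^sub>0 int) monoid" where
  "wedge_free K = free_Abelian_group ((K - {0}) \<times> (K - {0}))"

definition wedge_relations :: "'a::field set \<Rightarrow> ('a \<times> 'a \<Rightarrow>\<^sub>0 int) set" where
  "wedge_relations K = generate (wedge_free K)
     ({frag_of (x * y, z) - frag_of (x, z) - frag_of (y, z) | x y z.
         x \<in> K - {0} \<and> y \<in> K - {0} \<and> z \<in> K - {0}} \<union>
      {frag_of (x, y * z) - frag_of (x, y) - frag_of (x, z) | x y z.
         x \<in> K - {0} \<and> y \<in> K - {0} \<and> z \<in> K - {0}} \<union>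
      {frag_of (x, x) | x. x \<in> K - {0}})"

definition wedge_square :: "'a::field set \<Rightarrow> ('a \<times> 'a \<Rightarrow>\<^sub>0 int) set monoid" where
  "wedge_square K = wedge_free K Mod wedge_relations K"

definition wedge_square_mod_torsion ::
  "'a::field set \<Rightarrow> ('a \<times> 'a \<Rightarrow>\<^sub>0 int) set set monoid" where
  "wedge_square_mod_torsion K = wedge_square K Mod torsion_elements (wedge_square K)"

definition bloch_map ::
  "'a::field set \<Rightarrow> ('a \<Rightarrow>\<^sub>0 int) \<Rightarrow> ('a \<times> 'a \<Rightarrow>\<^sub>0 int) set set" where
  "bloch_map K \<xi> =
     torsion_elements (wedge_square K) #>\<^bsub>wedge_square K\<^esub>
       (wedge_relations K #>\<^bsub>wedge_free K\<^esub> frag_extend (\<lambda>x. frag_of (x, 1 - x)) \<xi>)"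

definition bloch_kernel :: "'a::field set \<Rightarrow> ('a \<Rightarrow>\<^sub>0 int) monoid" where
  "bloch_kernel K = (free_Abelian_group (K - {0, 1}))
     \<lparr>carrier := kernel (free_Abelian_group (K - {0, 1})) (wedge_square_mod_torsion K) (bloch_map K)\<rparr>"

definition bloch_relations :: "'a::field set \<Rightarrow> ('a \<Rightarrow>\<^sub>0 int) set" where
  "bloch_relations K = generate (free_Abelian_group (K - {0, 1}))
     ({frag_of x + frag_of (1 - x) | x. x \<in> K - {0, 1}} \<union>
      {frag_of x + frag_of (1 / x) | x. x \<in> K - {0, 1}} \<union>
      {frag_of x + frag_of y + frag_of (1 - x * y)
         + frag_of ((1 - x) / (1 - x * y)) + frag_of ((1 - y) / (1 - x * y)) | x y.
         x \<in> K - {0, 1} \<and> y \<in> K - {0, 1} \<and> x * y \<noteq> 1})"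

definition bloch_group :: "'a::field set \<Rightarrow> ('a \<Rightarrow>\<^sub>0 int) set monoid" where
  "bloch_group K = bloch_kernel K Mod bloch_relations K"

text \<open>The field \<open>\<rat>(Q\<^sub>1, \<dots>, Q\<^sub>r)\<close>: in characteristic 0 the prime field comes for free.\<close>

definition coordinate_field :: "complex^'r \<Rightarrow> complex set" where
  "coordinate_field Q = generate_field ring_of_type_algebra (range (($) Q))"

definition bloch_class :: "complex^'r \<Rightarrow> (complex \<Rightarrow>\<^sub>0 int) set" where
  "bloch_class Q = (let K = coordinate_field Q
     in bloch_relations K #>\<^bsub>bloch_kernel K\<^esub> (\<Sum>i\<in>UNIV. frag_of (Q $ i)))"

end

theory Submission
  imports Defs "HOL-Complex_Analysis.Complex_Analysis"
begin

text \<open>(a) Euler's identity sums out \<open>n\<^sub>3\<close> and \<open>n\<^sub>4\<close> and produces the factor \<open>(-q)\<^sub>\<infinity>\<^sup>2\<close>. In the remaining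
  double sum the terms with \<open>n\<^sub>1 + n\<^sub>2 = N\<close> add up, by a finite identity for Gaussian binomials in base
  \<open>q\<^sup>2\<close>, to \<open>q\<^bsup>N\<^sup>2\<^esup>/(q)\<^sub>N\<close>. What is left is the first Rogers--Ramanujan series, which two steps of the
  Bailey chain (Bressoud's finite form) turn into \<open>\<theta>\<^sub>5\<^sub>,\<^sub>1/\<eta>\<close>.

  (c) For the solutions of the first type the five-term relation at \<open>(u, u)\<close> identifies the element
  with \<open>[v]\<close>, \<open>v = u\<^sup>2\<close>. As \<open>1 - v = v\<^sup>2\<close>, all five terms of the relation at \<open>(v, v)\<close> are \<open>[v]\<close>, so
  \<open>5[v] = 0\<close>. For the second type the same relation also leads to \<open>[u\<^sup>2]\<close>, where now \<open>u\<^sup>2\<close> is a primitive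
  sixth root of unity. The Bloch--Wigner function induces a homomorphism to \<open>\<real>\<close> that does not vanish
  there. Its five-term relation holds because, with \<open>y\<close> fixed, the derivative in \<open>x\<close> along a segment is zero
  at all but finitely many points.\<close>

text \<open>In (a), \<open>A\<close> couples n_3 only to n_1 and n_4 only to n_2, so both can be
  summed out independently. Euler leaves 1/((-q)_{n_1} (-q)_{n_2}), and (q)_m (-q)_m = (q^2;q^2)_m
  is what puts the remaining double sum in base q^2. In (c) the obstacle is the real axis: the
  derivative of each Clausen summand has a logarithmic singularity there, and these cancel only in
  the sum. Hence the differential formula is proved off the axis and continuity at all points other
  than 0 and 1. Along a segment inside a small ball every argument of the five-term relation is a
  Moebius function of the parameter, which bounds the number of crossings of the axis. So the
  five-term sum is locally constant on a connected set, and real arguments supply its value.\<close>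

section \<open>The dilogarithm on the closed unit disc\<close>

text \<open>The term of index 0 vanishes, by \<open>x / 0 = 0\<close>.\<close>

definition li2 :: "complex \<Rightarrow> complex" where
  "li2 z = (suminf (\<lambda>n. z ^ n / of_nat n ^ 2))"

lemma li2_norm_bound:
  assumes "cmod z \<le> 1"
  shows "cmod (z ^ n / of_nat n ^ 2) \<le> inverse (real n ^ 2)"
  using power_le_one[OF norm_ge_zero assms, of n]
  by (cases "n = 0") (auto simp: norm_divide norm_power divide_simps)

lemma li2_summable:
  assumes "cmod z \<le> 1"
  shows "summable (\<lambda>n. z ^ n / of_nat n ^ 2)"
  by (rule summable_comparison_test'[OF inverse_power_summable[of 2, where 'a = real]])
     (use li2_norm_bound[OF assms] in auto)

lemma continuous_on_li2: "continuous_on (cball 0 1) li2"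
proof -
  have "uniform_limit (cball 0 1) (\<lambda>n z. \<Sum>k<n. z ^ k / of_nat k ^ 2) li2 sequentially"
    unfolding li2_def
    by (rule Weierstrass_m_test[OF _ inverse_power_summable[of 2, where 'a = real]])
       (use li2_norm_bound in auto)
  then show ?thesis
    by (rule uniform_limit_theorem[rotated])
       (simp, intro always_eventually allI continuous_on_sum, auto simp: divide_inverse intro!: continuous_on_mult_right continuous_on_power)
qed

lemma li2_cnj:
  assumes "cmod z \<le> 1"
  shows "li2 (cnj z) = cnj (li2 z)"
proof -
  have "(\<lambda>n. cnj (z ^ n / of_nat n ^ 2)) sums cnj (li2 z)"
    unfolding sums_cnj li2_def using li2_summable[OF assms] by (rule summable_sums)
  then show ?thesis
    by (simp add: li2_def sums_iff)
qed

text \<open>The value 1 fills the removable singularity at 0, so that the integrand is continuous on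
  the whole slit plane.\<close>

definition li2_integrand :: "complex \<Rightarrow> complex" where
  "li2_integrand z = (if z = 0 then 1 else - Ln (1 - z) / z)"

lemma li2_has_field_derivative:
  assumes z: "cmod z < 1"
  shows "(li2 has_field_derivative li2_integrand z) (at z)"
proof -
  define c :: "nat \<Rightarrow> complex" where "c n = 1 / of_nat n ^ 2" for n
  have li2: "li2 = (\<lambda>z. suminf (\<lambda>n. c n * z ^ n))"
    by (simp add: li2_def c_def fun_eq_iff)
  have "(li2 has_field_derivative (suminf (\<lambda>n. diffs c n * z ^ n))) (at z)"
    unfolding li2
    by (rule termdiffs_strong[of c 1]) (use z li2_summable[of 1] in \<open>auto simp: c_def\<close>)
  moreover have "(\<lambda>n. diffs c n * z ^ n) sums li2_integrand z"
  proof (cases "z = 0")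
    case True
    then show ?thesis
      using powser_sums_zero[of "diffs c"] by (simp add: li2_integrand_def diffs_def c_def)
  next
    case False
    have "(\<lambda>n. - ((-(-z)) ^ n) / of_nat n) sums Ln (1 + (-z))"
      by (rule Ln_series') (use z in auto)
    then have "(\<lambda>n. - (z ^ n / of_nat n)) sums Ln (1 - z)"
      by simp
    then have "(\<lambda>n. z ^ n / of_nat n) sums - Ln (1 - z)"
      using sums_minus by fastforce
    then have "(\<lambda>n. z ^ Suc n / of_nat (Suc n)) sums - Ln (1 - z)"
      by (subst sums_Suc_iff) simp
    then have "(\<lambda>n. z ^ Suc n / of_nat (Suc n) / z) sums (- Ln (1 - z) / z)"
      by (rule sums_divide)
    moreover have "z ^ Suc n / of_nat (Suc n) / z = diffs c n * z ^ n" for n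
    proof -
      have "(of_nat (Suc n) :: complex) \<noteq> 0" by (rule of_nat_neq_0)
      then show ?thesis
        using False by (simp add: diffs_def c_def field_simps power2_eq_square del: of_nat_Suc)
    qed
    ultimately show ?thesis using False by (simp add: li2_integrand_def)
  qed
  ultimately show ?thesis by (simp add: sums_iff)
qed

section \<open>Continuation of the dilogarithm to the slit plane\<close>

abbreviation slit_plane :: "complex set" where
  "slit_plane \<equiv> - (complex_of_real ` {1..})"

lemma slit_plane_slit:
  assumes "z \<in> slit_plane"
  shows "1 - z \<notin> \<real>\<^sub>\<le>\<^sub>0"
proof
  assume "1 - z \<in> \<real>\<^sub>\<le>\<^sub>0"
  then obtain r where "r \<le> 0" "1 - z = of_real r"
    by (auto elim: nonpos_Reals_cases)
  then have "z = of_real (1 - r)" "1 - r \<ge> 1" by (auto simp: algebra_simps)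
  then show False using assms by (auto simp del: of_real_diff)
qed

lemma continuous_on_li2_integrand: "continuous_on slit_plane li2_integrand"
proof -
  have "isCont li2_integrand z" if "z \<in> slit_plane" for z
  proof (cases "z = 0")
    case True
    have "((\<lambda>w::complex. - Ln (1 - w)) has_field_derivative 1) (at 0)"
      by (auto intro!: derivative_eq_intros)
    then have "((\<lambda>w::complex. - Ln (1 - w) / w) \<longlongrightarrow> 1) (at 0)"
      by (simp add: has_field_derivative_iff)
    then have "(li2_integrand \<longlongrightarrow> 1) (at 0)"
      by (rule Lim_transform_eventually)
        (auto simp: eventually_at li2_integrand_def intro!: exI[of _ 1])
    then show ?thesis
      using True by (simp add: isCont_def li2_integrand_def[of 0])
  next
    case False
    have "isCont (\<lambda>w. - Ln (1 - w) / w) z"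
      using False slit_plane_slit[OF that] by (intro continuous_intros) auto
    moreover have "\<forall>\<^sub>F w in nhds z. - Ln (1 - w) / w = li2_integrand w"
      using t1_space_nhds[OF False] by eventually_elim (auto simp: li2_integrand_def)
    ultimately show ?thesis by (simp add: isCont_cong)
  qed
  then show ?thesis by (intro continuous_at_imp_continuous_on) blast
qed

lemma open_slit_plane: "open slit_plane"
proof -
  have "closed (complex_of_real ` {1..})"
    by (rule closed_slot_right)
  then show ?thesis by blast
qed

text \<open>The extension makes the dilogarithm differentiable at the points of the unit circle other
  than 1, where the power series gives only continuity.\<close>

lemma li2_extension:
  obtains f where "\<And>z. z \<in> slit_plane \<Longrightarrow> (f has_field_derivative li2_integrand z) (at z)"
    and "\<And>z. z \<in> slit_plane \<Longrightarrow> cmod z \<le> 1 \<Longrightarrow> f z = li2 z"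
proof -
  have "li2_integrand field_differentiable at z" if "z \<in> slit_plane - {0}" for z
  proof -
    have "(\<lambda>w. - Ln (1 - w) / w) field_differentiable at z"
    proof -
      have "((\<lambda>w. - Ln (1 - w)) has_field_derivative inverse (1 - z)) (at z)"
      proof -
        have "((\<lambda>w. Ln (1 - w)) has_field_derivative inverse (1 - z) * (0 - 1)) (at z)"
          by (rule DERIV_chain2[OF has_field_derivative_Ln])
             (use that slit_plane_slit in \<open>auto intro!: DERIV_diff simp del: diff_0\<close>)
        from DERIV_minus[OF this] show ?thesis by simp
      qed
      from DERIV_divide[OF this DERIV_ident] show ?thesis
        using that unfolding field_differentiable_def by blast
    qed
    moreover have "\<forall>\<^sub>F w in nhds z. - Ln (1 - w) / w = li2_integrand w"
      using t1_space_nhds[of z 0] that by (auto simp: li2_integrand_def elim: eventually_mono)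
    ultimately show ?thesis
      unfolding field_differentiable_def by (subst (asm) DERIV_cong_ev[OF refl _ refl]) auto
  qed
  \<comment> \<open>The primitive on a starlike open set may have finitely many points where the
    integrand is only known to be continuous; here this is 0.\<close>
  then obtain g where g: "\<And>z. z \<in> slit_plane \<Longrightarrow> (g has_field_derivative li2_integrand z) (at z)"
    using holomorphic_starlike_primitive[OF continuous_on_li2_integrand
        starlike_slotted_complex_plane_right open_slit_plane, of "{0}"] by auto
  have ball: "z \<in> slit_plane" if "cmod z < 1" for z
    using that by (auto simp: abs_if split: if_splits)
  have "\<exists>c. \<forall>z\<in>ball 0 1. g z - li2 z = c"
  proof (rule has_field_derivative_zero_constant)
    fix z :: complex assume "z \<in> ball 0 1"
    then have "cmod z < 1" by simp
    from DERIV_diff[OF g[OF ball[OF this]] li2_has_field_derivative[OF this]]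
    show "((\<lambda>z. g z - li2 z) has_field_derivative 0) (at z within ball 0 1)"
      by (simp add: has_field_derivative_at_within)
  qed auto
  then obtain c where c: "\<And>z. cmod z < 1 \<Longrightarrow> g z = li2 z + c"
    by (metis dist_0_norm mem_ball diff_eq_eq add.commute)
  show thesis
  proof (rule that[of "\<lambda>z. g z - c"])
    show "((\<lambda>z. g z - c) has_field_derivative li2_integrand z) (at z)" if "z \<in> slit_plane" for z
      using DERIV_diff[OF g[OF that] DERIV_const[of c]] by simp
    show "g z - c = li2 z" if z: "z \<in> slit_plane" "cmod z \<le> 1" for z
    proof -
      \<comment> \<open>Agreement is known in the open disc only. A boundary point is approached
        along its radius, where \<open>g\<close> is continuous by differentiability and
        \<open>li2\<close> by uniform convergence.\<close>
      define r :: "nat \<Rightarrow> complex" where "r n = of_real (1 - 1 / real (Suc n)) * z" for n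
      have "(\<lambda>n. 1 - 1 / real (Suc n)) \<longlonglongrightarrow> 1 - 0"
        by (intro tendsto_intros LIMSEQ_Suc[OF lim_1_over_n])
      then have "(\<lambda>n. complex_of_real (1 - 1 / real (Suc n)) * z) \<longlonglongrightarrow> of_real (1 - 0) * z"
        by (rule tendsto_mult[OF tendsto_of_real tendsto_const])
      then have r: "r \<longlonglongrightarrow> z"
        unfolding r_def by (simp only: diff_zero of_real_1 mult_1)
      have rn: "cmod (r n) < 1" for n
      proof -
        define s where "s = 1 - 1 / real (Suc n)"
        have s: "0 \<le> s" "s < 1" by (auto simp: s_def)
        have "cmod (r n) = s * cmod z"
          using s unfolding r_def s_def[symmetric] by (simp add: norm_mult)
        also have "\<dots> \<le> s * 1"
          using s z by (intro mult_left_mono) auto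
        finally show ?thesis using s by simp
      qed
      have "(\<lambda>n. g (r n)) \<longlonglongrightarrow> g z"
        by (rule isCont_tendsto_compose[OF DERIV_isCont[OF g] r]) (fact z)
      moreover have *: "(\<lambda>n. li2 (r n)) \<longlonglongrightarrow> li2 z"
        by (rule continuous_on_tendsto_compose[OF continuous_on_li2 r])
           (use z rn in \<open>auto simp: less_imp_le\<close>)
      from tendsto_add[OF this tendsto_const[of c]] have "(\<lambda>n. li2 (r n) + c) \<longlonglongrightarrow> li2 z + c" .
      ultimately have "g z = li2 z + c"
        using c[OF rn] LIMSEQ_unique by auto
      then show ?thesis by simp
    qed
  qed
qed

section \<open>The Bloch--Wigner function and the five-term relation\<close>

text \<open>This is \<open>Cl\<^sub>2(2 arg w)\<close>; in particular it is unchanged if \<open>w\<close> is multiplied by a nonzero real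
  number.\<close>

definition clausen_arg :: "complex \<Rightarrow> real" where
  "clausen_arg w = Im (li2 (w / cnj w))"

text \<open>An inequality, so as to include w = 0, where the quotient is 0 and not on the unit
  circle.\<close>

lemma norm_divide_cnj: "cmod (w / cnj w) \<le> 1"
  by (cases "w = 0") (auto simp: norm_divide)

lemma clausen_arg_inverse: "clausen_arg (1 / w) = - clausen_arg w"
proof -
  have "clausen_arg (1 / w) = Im (li2 (cnj (w / cnj w)))"
    by (simp add: clausen_arg_def)
  also have "\<dots> = - clausen_arg w"
    using li2_cnj[OF norm_divide_cnj] by (simp add: clausen_arg_def)
  finally show ?thesis .
qed

lemma clausen_arg_real:
  assumes "Im w = 0"
  shows "clausen_arg w = 0"
proof -
  have "cnj w = w" using assms by (simp add: complex_eq_iff)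
  then have "cnj (w / cnj w) = w / cnj w" by simp
  then have "li2 (w / cnj w) = cnj (li2 (w / cnj w))"
    using li2_cnj[OF norm_divide_cnj, of w] by simp
  then show ?thesis by (simp add: clausen_arg_def complex_eq_iff)
qed

text \<open>This includes nonzero real w. There w / cnj w = 1, where the derivative formula breaks
  down but the series is still continuous.\<close>

lemma continuous_on_clausen_arg: "continuous_on (- {0}) clausen_arg"
  unfolding clausen_arg_def
  by (intro continuous_intros continuous_on_compose2[OF continuous_on_li2])
     (use norm_divide_cnj in auto)

text \<open>The formula is d Cl_2(2 theta) = -2 log|2 sin theta| d theta for theta = arg g: the
  differential of arg g is Im(g'/g), and |sin theta| = |Im g| / |g|. For nonreal g the quotient g /
  cnj g avoids the slit, so the continued dilogarithm can be differentiated.\<close>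

lemma has_real_derivative_clausen_arg:
  assumes g: "(g has_vector_derivative g') (at t)" and im: "Im (g t) \<noteq> 0"
  shows "((\<lambda>t. clausen_arg (g t)) has_real_derivative
    - 2 * Im (g' / g t) * (ln \<bar>2 * Im (g t)\<bar> - ln (cmod (g t)))) (at t)"
proof -
  obtain f where f: "\<And>z. z \<in> slit_plane \<Longrightarrow> (f has_field_derivative li2_integrand z) (at z)"
    and f_eq: "\<And>z. z \<in> slit_plane \<Longrightarrow> cmod z \<le> 1 \<Longrightarrow> f z = li2 z"
    using li2_extension by metis
  have slit: "w / cnj w \<in> slit_plane" if "Im w \<noteq> 0" for w
  proof
    assume "w / cnj w \<in> complex_of_real ` {1..}"
    then obtain r where r: "r \<ge> 1" "w / cnj w = of_real r" by auto
    from that have "w \<noteq> 0" by auto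
    have "cmod (w / cnj w) = r" using r by simp
    moreover have "cmod (w / cnj w) = 1" using \<open>w \<noteq> 0\<close> by (simp add: norm_divide)
    ultimately have "w / cnj w = 1" using r by simp
    then have "w = cnj w" using \<open>w \<noteq> 0\<close> by (simp add: divide_simps)
    then show False using that by (simp add: complex_eq_iff)
  qed
  define w where "w = g t"
  have w: "w \<noteq> 0" "cnj w \<noteq> 0" using im by (auto simp: w_def)
  define z where "z = w / cnj w"
  have z: "z \<noteq> 0" "z \<in> slit_plane" using w slit im by (auto simp: z_def w_def)
  have dcnj: "((\<lambda>t. cnj (g t)) has_vector_derivative cnj g') (at t)"
    using g by (rule has_vector_derivative_cnj)
  define z' where "z' = (g' * cnj w - w * cnj g') / (cnj w * cnj w)"
  have "((\<lambda>t. g t / cnj (g t)) has_vector_derivative z') (at t)"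
  proof -
    have "((\<lambda>t. inverse (cnj (g t))) has_vector_derivative cnj g' * - (inverse (cnj w) ^ 2)) (at t)"
    proof -
      have "(inverse has_field_derivative - (inverse (cnj w) ^ 2)) (at (cnj (g t)))"
        using w by (auto simp: w_def power2_eq_square intro!: derivative_eq_intros)
      from field_vector_diff_chain_at[OF dcnj this] show ?thesis by (simp add: o_def)
    qed
    note D = has_vector_derivative_mult[OF g this]
    have "g t * (cnj g' * - (inverse (cnj w))\<^sup>2) + g' * inverse (cnj (g t)) = z'"
      using w by (simp add: z'_def field_simps power2_eq_square flip: w_def)
    with D show ?thesis by (simp add: divide_inverse)
  qed
  then have "((f \<circ> (\<lambda>t. g t / cnj (g t))) has_vector_derivative z' * li2_integrand z) (at t)"
    by (rule field_vector_diff_chain_at) (use f[OF z(2)] in \<open>simp add: z_def w_def\<close>)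
  then have "((\<lambda>t. Im (f (g t / cnj (g t)))) has_real_derivative Im (z' * li2_integrand z)) (at t)"
    unfolding o_def has_real_derivative_iff_has_vector_derivative
    by (rule bounded_linear.has_vector_derivative[OF bounded_linear_Im])
  moreover have "\<forall>\<^sub>F t in nhds t. Im (f (g t / cnj (g t))) = clausen_arg (g t)"
  proof -
    have "isCont g t" using g has_vector_derivative_continuous by blast
    then have "((\<lambda>t. Im (g t)) \<longlongrightarrow> Im (g t)) (nhds t)"
      by (auto simp: isCont_def tendsto_at_iff_tendsto_nhds intro!: tendsto_intros)
    then have "\<forall>\<^sub>F t in nhds t. Im (g t) \<noteq> 0"
      using im tendsto_imp_eventually_ne by blast
    then show ?thesis
      proof eventually_elim
      case (elim t)
      from f_eq[OF slit[OF elim] norm_divide_cnj] show ?case by (simp add: clausen_arg_def)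
    qed
  qed
  ultimately have "((\<lambda>t. clausen_arg (g t)) has_real_derivative Im (z' * li2_integrand z)) (at t)"
    by (subst (asm) DERIV_cong_ev[OF refl _ refl])
  moreover have "Im (z' * li2_integrand z)
      = - 2 * Im (g' / g t) * (ln \<bar>2 * Im (g t)\<bar> - ln (cmod (g t)))"
  proof -
    have "z' * li2_integrand z = - (z' / z) * Ln (1 - z)"
      using z by (simp add: li2_integrand_def)
    also have "z' / z = g' / w - cnj (g' / w)"
      using w by (simp add: z'_def z_def field_simps)
    also have "\<dots> = 2 * \<i> * of_real (Im (g' / w))"
      by (simp add: complex_eq_iff del: complex_cnj_divide)
    finally have "Im (z' * li2_integrand z) = - 2 * Im (g' / w) * Re (Ln (1 - z))"
      by simp
    also have "Re (Ln (1 - z)) = ln (cmod (1 - z))"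
      using z by (intro Re_Ln) (auto intro!: image_eqI[of _ _ 1])
    also have "1 - z = (cnj w - w) / cnj w"
      using w by (simp add: z_def field_simps)
    also have "cnj w - w = - 2 * \<i> * of_real (Im w)"
      by (simp add: complex_eq_iff)
    also have "cmod (- 2 * \<i> * of_real (Im w) / cnj w) = \<bar>2 * Im w\<bar> / cmod w"
      by (simp add: norm_divide norm_mult abs_mult)
    also have "ln \<dots> = ln \<bar>2 * Im w\<bar> - ln (cmod w)"
      using w im by (intro ln_divide_pos) (auto simp: w_def)
    finally show ?thesis by (simp add: w_def)
  qed
  ultimately show ?thesis by simp
qed

text \<open>Twice the usual Bloch--Wigner function, written as a sum over the angles of the Euclidean
  triangle with vertices 0, 1, \<open>z\<close>. This form is defined and continuous across the real axis, and its
  six-fold symmetry is immediate.\<close>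

definition bloch_wigner :: "complex \<Rightarrow> real" where
  "bloch_wigner z = clausen_arg z + clausen_arg (1 - 1 / z) + clausen_arg (1 / (1 - z))"

lemma bloch_wigner_inverse:
  assumes "z \<noteq> 0" "z \<noteq> 1"
  shows "bloch_wigner (1 / z) = - bloch_wigner z"
proof -
  have "clausen_arg (1 - z) = - clausen_arg (1 / (1 - z))"
    using clausen_arg_inverse[of "1 - z"] by simp
  then show ?thesis
    using clausen_arg_inverse[of z] clausen_arg_inverse[of "1 - 1 / z"]
    by (simp add: bloch_wigner_def)
qed

lemma bloch_wigner_one_minus:
  assumes "z \<noteq> 0" "z \<noteq> 1"
  shows "bloch_wigner (1 - z) = - bloch_wigner z"
proof -
  have "1 - 1 / (1 - z) = 1 / (1 - 1 / z)" using assms by (auto simp: field_simps)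
  then have "clausen_arg (1 - 1 / (1 - z)) = - clausen_arg (1 - 1 / z)"
    by (simp only: clausen_arg_inverse)
  then show ?thesis
    using clausen_arg_inverse[of z] clausen_arg_inverse[of "1 - z"]
    by (simp add: bloch_wigner_def)
qed

lemma bloch_wigner_real:
  assumes "Im z = 0"
  shows "bloch_wigner z = 0"
proof -
  have "Im (1 - 1 / z) = 0" "Im (1 / (1 - z)) = 0"
    using assms by (auto simp: Im_divide)
  then show ?thesis using assms by (simp add: bloch_wigner_def clausen_arg_real)
qed

lemma continuous_on_bloch_wigner: "continuous_on (- {0, 1}) bloch_wigner"
  unfolding bloch_wigner_def
  by (intro continuous_intros continuous_on_compose2[OF continuous_on_clausen_arg]) auto

text \<open>The differential \<open>2 (log|z| d arg(1 - z) - log|1 - z| d arg z)\<close>, evaluated at a tangent vector \<open>z'\<close>.\<close>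

definition dilog_form :: "complex \<Rightarrow> complex \<Rightarrow> real" where
  "dilog_form z z' = - 2 * (ln (cmod z) * Im (z' / (1 - z)) + ln (cmod (1 - z)) * Im (z' / z))"

text \<open>The three arguments z, 1 - 1/z, 1/(1 - z) have product -1, so their logarithmic
  derivatives u, -u - v, v add up to 0. Their imaginary parts differ from Im z by the factors 1,
  1/|z|^2, 1/|1 - z|^2. Hence the singular term log|2 Im z| has total coefficient 0, and only log|z|
  and log|1 - z| survive.\<close>

lemma has_real_derivative_bloch_wigner:
  assumes g: "(g has_vector_derivative g') (at t)" and im: "Im (g t) \<noteq> 0"
  shows "((\<lambda>t. bloch_wigner (g t)) has_real_derivative dilog_form (g t) g') (at t)"
proof -
  define z where "z = g t"
  have z: "z \<noteq> 0" "1 - z \<noteq> 0" using im by (auto simp: z_def)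
  define u v where "u = g' / z" and "v = g' / (1 - z)"
  have d2: "((\<lambda>t. 1 - 1 / g t) has_vector_derivative (g' * (1 / z\<^sup>2))) (at t)"
  proof -
    have "((\<lambda>z. 1 - 1 / z) has_field_derivative 1 / z\<^sup>2) (at (g t))"
      using z by (auto simp: z_def power2_eq_square intro!: derivative_eq_intros)
    from field_vector_diff_chain_at[OF g this] show ?thesis by (simp add: o_def)
  qed
  have d3: "((\<lambda>t. 1 / (1 - g t)) has_vector_derivative (g' * (1 / (1 - z)\<^sup>2))) (at t)"
  proof -
    have "((\<lambda>z. 1 / (1 - z)) has_field_derivative 1 / (1 - z)\<^sup>2) (at (g t))"
      using z by (auto simp: z_def power2_eq_square intro!: derivative_eq_intros)
    from field_vector_diff_chain_at[OF g this] show ?thesis by (simp add: o_def)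
  qed
  have im2: "Im (1 - 1 / z) = Im z / (cmod z)\<^sup>2"
    by (simp add: Im_divide cmod_power2)
  have im3: "Im (1 / (1 - z)) = Im z / (cmod (1 - z))\<^sup>2"
    by (simp add: Im_divide cmod_power2)
  have n2: "cmod (1 - 1 / z) = cmod (1 - z) / cmod z"
    using z norm_minus_commute[of 1 z] by (simp add: divide_simps norm_divide)
  have l1: "ln \<bar>2 * Im z / c\<^sup>2\<bar> = ln \<bar>2 * Im z\<bar> - 2 * ln c" if "c > 0" for c
    using that im by (simp add: ln_div abs_mult z_def ln_mult ln_realpow)
  have l2: "ln \<bar>2 * Im (1 - 1 / z)\<bar> - ln (cmod (1 - 1 / z))
      = ln \<bar>2 * Im z\<bar> - ln (cmod z) - ln (cmod (1 - z))"
    unfolding im2 n2 using l1[of "cmod z"] z by (simp add: ln_div)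
  have l3: "ln \<bar>2 * Im (1 / (1 - z))\<bar> - ln (cmod (1 / (1 - z)))
      = ln \<bar>2 * Im z\<bar> - ln (cmod (1 - z))"
    unfolding im3 using l1[of "cmod (1 - z)"] z by (simp add: ln_div norm_divide)
  have q2: "g' * (1 / z\<^sup>2) / (1 - 1 / z) = - u - v"
    using z by (simp add: u_def v_def divide_simps power2_eq_square) (simp add: algebra_simps)
  have q3: "g' * (1 / (1 - z)\<^sup>2) / (1 / (1 - z)) = v"
    using z by (simp add: v_def divide_simps power2_eq_square)
  have "Im (1 - 1 / g t) \<noteq> 0" "Im (1 / (1 - g t)) \<noteq> 0"
    using im z by (auto simp flip: z_def simp: im2[simplified] im3)
  note D = DERIV_add[OF DERIV_add[OF has_real_derivative_clausen_arg[OF g im]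
        has_real_derivative_clausen_arg[OF d2 this(1)]] has_real_derivative_clausen_arg[OF d3 this(2)]]
  have "((\<lambda>t. bloch_wigner (g t)) has_real_derivative
     - 2 * Im u * (ln \<bar>2 * Im z\<bar> - ln (cmod z))
     + - 2 * Im (- u - v) * (ln \<bar>2 * Im z\<bar> - ln (cmod z) - ln (cmod (1 - z)))
     + - 2 * Im v * (ln \<bar>2 * Im z\<bar> - ln (cmod (1 - z)))) (at t)"
    using D unfolding z_def[symmetric] l2 l3 q2 q3 u_def[symmetric] bloch_wigner_def .
  then show ?thesis
    by (simp add: dilog_form_def flip: z_def u_def v_def) (simp add: algebra_simps)
qed

lemma finite_quadratic_roots:
  fixes a b c :: real
  assumes "\<not> (\<forall>t. a + b * t + c * t\<^sup>2 = 0)"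
  shows "finite {t. a + b * t + c * t\<^sup>2 = 0}"
proof -
  have eq: "poly [:a, b, c:] t = a + b * t + c * t\<^sup>2" for t
    by (simp add: algebra_simps power2_eq_square)
  have "[:a, b, c:] \<noteq> 0" using assms by auto
  from poly_roots_finite[OF this] show ?thesis by (simp only: eq)
qed

text \<open>The exceptional parameters are those where the path crosses the real axis: the roots of a
  quadratic polynomial. If that polynomial vanishes identically, then so do the function and the form.\<close>

lemma has_real_derivative_bloch_wigner_moebius:
  fixes a b c d :: complex
  defines "g \<equiv> \<lambda>t. (a + of_real t * b) / (c + of_real t * d)"
    and "g' \<equiv> \<lambda>t. (b * c - a * d) / (c + of_real t * d)\<^sup>2"
  assumes nz: "\<And>t. t \<in> {0..1} \<Longrightarrow> c + of_real t * d \<noteq> 0"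
  obtains k where "finite k" and "\<And>t. t \<in> {0<..<1} - k \<Longrightarrow>
    ((\<lambda>t. bloch_wigner (g t)) has_real_derivative dilog_form (g t) (g' t)) (at t)"
proof -
  \<comment> \<open>The numerator of Im (g t) once the denominator has been made positive by its
    conjugate.\<close>
  define p where "p t = Im ((a + of_real t * b) * cnj (c + of_real t * d))" for t
  have p: "p t = Im (a * cnj c) + Im (a * cnj d + b * cnj c) * t + Im (b * cnj d) * t\<^sup>2" for t
    by (simp add: p_def algebra_simps power2_eq_square)
  have g0: "Im (g t) = 0 \<longleftrightarrow> p t = 0" if "t \<in> {0..1}" for t
  proof -
    have "g t = (a + of_real t * b) * cnj (c + of_real t * d) / of_real ((cmod (c + of_real t * d))\<^sup>2)"
      unfolding g_def by (rule complex_div_cnj)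
    then have "Im (g t) = p t / (cmod (c + of_real t * d))\<^sup>2"
      unfolding p_def by (simp only: Im_divide_of_real)
    then show ?thesis using nz[OF that] by simp
  qed
  have dg: "(g has_vector_derivative g' t) (at t)" if "t \<in> {0..1}" for t
  proof -
    have "((\<lambda>z. (a + z * b) / (c + z * d)) has_field_derivative g' t) (at (of_real t))"
      using nz[OF that] by (auto intro!: derivative_eq_intros simp: g'_def power2_eq_square algebra_simps)
    from field_vector_diff_chain_at[OF has_vector_derivative_of_real[OF DERIV_ident] this]
    show ?thesis by (simp add: o_def g_def)
  qed
  show thesis
  proof (cases "\<forall>t. p t = 0")
    case False
    show thesis
    proof (rule that[of "{t. p t = 0}"])
      show "finite {t. p t = 0}"
        using False unfolding p by (rule finite_quadratic_roots)
      show "((\<lambda>t. bloch_wigner (g t)) has_real_derivative dilog_form (g t) (g' t)) (at t)"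
        if "t \<in> {0<..<1} - {t. p t = 0}" for t
        using that g0[of t] by (intro has_real_derivative_bloch_wigner dg) auto
    qed
  next
    case True
    show thesis
    proof (rule that[of "{}"])
      fix t :: real assume t: "t \<in> {0<..<1} - {}"
      have ev: "\<forall>\<^sub>F s in nhds t. s \<in> {0<..<1}"
        using t by (intro eventually_nhds_in_open) auto
      then have ev0: "\<forall>\<^sub>F s in nhds t. Im (g s) = 0"
        by eventually_elim (use True g0 in auto)
      have "((\<lambda>s. Im (g s)) has_real_derivative Im (g' t)) (at t)"
        using bounded_linear.has_vector_derivative[OF bounded_linear_Im dg[of t]] t
        by (simp add: has_real_derivative_iff_has_vector_derivative)
      moreover have "((\<lambda>s. Im (g s)) has_real_derivative 0) (at t)"
        by (subst DERIV_cong_ev[OF refl ev0 refl]) simp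
      ultimately have "Im (g' t) = 0" by (rule DERIV_unique)
      moreover have "Im (g t) = 0" using g0[of t] True t by auto
      ultimately have "dilog_form (g t) (g' t) = 0"
        by (simp add: dilog_form_def Im_divide)
      moreover have "((\<lambda>t. bloch_wigner (g t)) has_real_derivative 0) (at t)"
      proof -
        have "\<forall>\<^sub>F s in nhds t. bloch_wigner (g s) = 0"
          using ev0 by eventually_elim (rule bloch_wigner_real)
        then show ?thesis by (subst DERIV_cong_ev[OF refl _ refl]) auto
      qed
      ultimately show "((\<lambda>t. bloch_wigner (g t)) has_real_derivative dilog_form (g t) (g' t)) (at t)"
        by simp
    qed simp
  qed
qed

section \<open>The five-term relation\<close>

definition five_term :: "complex \<Rightarrow> complex \<Rightarrow> real" where
  "five_term x y = bloch_wigner x + bloch_wigner y + bloch_wigner (1 - x * y)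
     + bloch_wigner ((1 - x) / (1 - x * y)) + bloch_wigner ((1 - y) / (1 - x * y))"

text \<open>With x' a tangent vector in x, the last four items are z'/z and z'/(1 - z) for the last
  two arguments z of the five-term relation, expressed through the logarithmic derivatives of x, 1 -
  x and 1 - x y.\<close>

lemma five_term_quotients:
  fixes x y x' :: "'a::field"
  assumes "x \<noteq> 0" "y \<noteq> 0" "1 - x \<noteq> 0" "1 - y \<noteq> 0" "1 - x * y \<noteq> 0"
  shows "1 - (1 - x) / (1 - x * y) = x * (1 - y) / (1 - x * y)"
    "1 - (1 - y) / (1 - x * y) = y * (1 - x) / (1 - x * y)"
    "x' * (y - 1) / (1 - x * y)\<^sup>2 / ((1 - x) / (1 - x * y)) = x' * y / (1 - x * y) - x' / (1 - x)"
    "x' * (y - 1) / (1 - x * y)\<^sup>2 / (x * (1 - y) / (1 - x * y)) = - (x' / x + x' * y / (1 - x * y))"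
    "x' * y * (1 - y) / (1 - x * y)\<^sup>2 / ((1 - y) / (1 - x * y)) = x' * y / (1 - x * y)"
    "x' * y * (1 - y) / (1 - x * y)\<^sup>2 / (y * (1 - x) / (1 - x * y)) = x' / (1 - x) - x' * y / (1 - x * y)"
  using assms by (simp_all add: divide_simps power2_eq_square) (simp_all add: algebra_simps)

text \<open>The form depends only on z \<and> (1 - z), since log|f| d arg g - log|g| d arg f is
  bilinear and alternating. Each argument and its complement is a product of powers of x, y, 1 - x,
  1 - y, 1 - x y, and after expansion everything cancels. The argument y itself is fixed and has no
  differential.\<close>

lemma dilog_form_five_term:
  assumes "x \<noteq> 0" "x \<noteq> 1" "y \<noteq> 0" "y \<noteq> 1" "x * y \<noteq> 1"
  shows "dilog_form x x' + dilog_form (1 - x * y) (- (x' * y))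
    + dilog_form ((1 - x) / (1 - x * y)) (x' * (y - 1) / (1 - x * y)\<^sup>2)
    + dilog_form ((1 - y) / (1 - x * y)) (x' * y * (1 - y) / (1 - x * y)\<^sup>2) = 0"
proof -
  have nz: "1 - x \<noteq> 0" "1 - y \<noteq> 0" "1 - x * y \<noteq> 0" using assms by auto
  define a b c where "a = x' / x" and "b = x' / (1 - x)" and "c = x' * y / (1 - x * y)"
  define la lb lc ly lm where "la = ln (cmod x)" and "lb = ln (cmod (1 - x))"
    and "lc = ln (cmod (1 - x * y))" and "ly = ln (cmod y)" and "lm = ln (cmod (1 - y))"
  have 1: "dilog_form x x' = - 2 * (la * Im b + lb * Im a)"
    by (simp add: dilog_form_def a_def b_def la_def lb_def)
  have "- (x' * y) / (1 - (1 - x * y)) = - a" "- (x' * y) / (1 - x * y) = - c"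
    using assms by (auto simp: a_def c_def)
  moreover have "ln (cmod (1 - (1 - x * y))) = la + ly"
    using assms by (simp add: la_def ly_def norm_mult ln_mult)
  ultimately have 2: "dilog_form (1 - x * y) (- (x' * y)) = 2 * (lc * Im a + (la + ly) * Im c)"
    unfolding dilog_form_def by (simp add: lc_def)
  note quot = five_term_quotients(3-6)[where x' = x', OF assms(1,3) nz, folded a_def b_def c_def]
  note e = five_term_quotients(1,2)[OF assms(1,3) nz]
  have "x' * (y - 1) / (1 - x * y)\<^sup>2 / ((1 - x) / (1 - x * y)) = c - b"
    by (rule quot)
  moreover have "x' * (y - 1) / (1 - x * y)\<^sup>2 / (x * (1 - y) / (1 - x * y)) = - (a + c)"
    by (rule quot)
  moreover have "ln (cmod ((1 - x) / (1 - x * y))) = lb - lc"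
    "ln (cmod (x * (1 - y) / (1 - x * y))) = la + lm - lc"
    using nz assms by (simp_all add: norm_divide norm_mult ln_div ln_mult la_def lb_def lc_def lm_def)
  ultimately have 3: "dilog_form ((1 - x) / (1 - x * y)) (x' * (y - 1) / (1 - x * y)\<^sup>2)
      = 2 * ((lb - lc) * Im (a + c) - (la + lm - lc) * Im (c - b))"
    unfolding dilog_form_def e by (simp only:) (simp add: algebra_simps)
  have "x' * y * (1 - y) / (1 - x * y)\<^sup>2 / ((1 - y) / (1 - x * y)) = c"
    by (rule quot)
  moreover have "x' * y * (1 - y) / (1 - x * y)\<^sup>2 / (y * (1 - x) / (1 - x * y)) = b - c"
    by (rule quot)
  moreover have "ln (cmod ((1 - y) / (1 - x * y))) = lm - lc"
    "ln (cmod (y * (1 - x) / (1 - x * y))) = ly + lb - lc"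
    using nz assms by (simp_all add: norm_divide norm_mult ln_div ln_mult ly_def lb_def lc_def lm_def)
  ultimately have 4: "dilog_form ((1 - y) / (1 - x * y)) (x' * y * (1 - y) / (1 - x * y)\<^sup>2)
      = - 2 * ((lm - lc) * Im (b - c) + (ly + lb - lc) * Im c)"
    unfolding dilog_form_def e by (simp only:)
  show ?thesis unfolding 1 2 3 4 by (simp add: algebra_simps)
qed

lemma five_term_arguments:
  fixes x y :: "'a::field"
  assumes "x \<noteq> 0" "x \<noteq> 1" "y \<noteq> 0" "y \<noteq> 1" "x * y \<noteq> 1"
  shows "1 - x * y \<notin> {0, 1}" "(1 - x) / (1 - x * y) \<notin> {0, 1}" "(1 - y) / (1 - x * y) \<notin> {0, 1}"
  using assms by (auto simp: divide_simps)

lemma continuous_on_five_term: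
  assumes "y \<noteq> 0" "y \<noteq> 1"
  shows "continuous_on (- {0, 1, 1 / y}) (\<lambda>x. five_term x y)"
proof -
  have nz: "x * y \<noteq> 1" if "x \<in> - {0, 1, 1 / y}" for x
    using that assms by (auto simp: field_simps)
  define U where "U = - {0, 1, 1 / y}"
  have args: "1 - x * y \<in> - {0, 1}" "(1 - x) / (1 - x * y) \<in> - {0, 1}"
    "(1 - y) / (1 - x * y) \<in> - {0, 1}" "x \<in> - {0, 1}" if "x \<in> U" for x
    using that five_term_arguments[OF _ _ assms nz[of x]] by (simp_all add: U_def)
  have den: "\<forall>x\<in>U. 1 - x * y \<noteq> 0" using args(1) by blast
  note C = continuous_on_compose2[OF continuous_on_bloch_wigner]
  have den_cont: "continuous_on U (\<lambda>x. 1 - x * y)"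
    by (rule continuous_on_diff[OF continuous_on_const continuous_on_mult_right[OF continuous_on_id]])
  have num_cont: "continuous_on U (\<lambda>x. 1 - x)"
    by (rule continuous_on_diff[OF continuous_on_const continuous_on_id])
  have "continuous_on U (\<lambda>x. bloch_wigner x)"
    by (rule C[OF continuous_on_id image_subsetI[OF args(4)]])
  moreover have "continuous_on U (\<lambda>x. bloch_wigner (1 - x * y))"
    by (rule C[OF den_cont image_subsetI[OF args(1)]])
  moreover have "continuous_on U (\<lambda>x. bloch_wigner ((1 - x) / (1 - x * y)))"
    by (rule C[OF continuous_on_divide[OF num_cont den_cont den] image_subsetI[OF args(2)]])
  moreover have "continuous_on U (\<lambda>x. bloch_wigner ((1 - y) / (1 - x * y)))"
    by (rule C[OF continuous_on_divide[OF continuous_on_const den_cont den] image_subsetI[OF args(3)]])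
  ultimately show ?thesis
    unfolding five_term_def U_def[symmetric] by (intro continuous_on_add continuous_on_const)
qed

text \<open>The plane without three points is connected, so local constancy suffices. In a ball that
  avoids the three points, the centre is joined to any other point by a segment, along which the
  four arguments depending on x are quotients of affine functions of t.\<close>

lemma five_term_constant:
  assumes y: "y \<noteq> 0" "y \<noteq> 1" and x: "x \<in> - {0, 1, 1 / y}" "x' \<in> - {0, 1, 1 / y}"
  shows "five_term x y = five_term x' y"
proof (rule connected_local_const[OF _ x])
  show "connected (- {0, 1, 1 / y})"
    using connected_open_delete_finite[of UNIV "{0, 1, 1 / y}"] by (simp add: Compl_eq_Diff_UNIV connected_UNIV)
  show "\<forall>a\<in>- {0, 1, 1 / y}. \<forall>\<^sub>F b in at a within - {0, 1, 1 / y}. five_term a y = five_term b y"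
  proof
    fix p assume "p \<in> - {0, 1, 1 / y}"
    moreover have "open (- {0, 1, 1 / y})" by (intro open_Compl finite_imp_closed) auto
    ultimately obtain e where e: "e > 0" "ball p e \<subseteq> - {0, 1, 1 / y}"
      using openE by metis
    have const: "five_term r y = five_term p y" if r: "r \<in> ball p e" for r
    proof -
      define b where "b = r - p"
      define \<gamma> where "\<gamma> t = p + of_real t * b" for t
      have \<gamma>: "\<gamma> t \<in> - {0, 1, 1 / y}" if "t \<in> {0..1}" for t
      proof -
        have "dist p (\<gamma> t) = t * dist p r"
          using that by (simp add: \<gamma>_def b_def dist_norm norm_mult norm_minus_commute)
        also have "\<dots> \<le> 1 * dist p r" using that by (intro mult_right_mono) auto
        also have "\<dots> < e" using r by simp
        finally have "\<gamma> t \<in> ball p e" by simp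
        then show ?thesis using e by blast
      qed
      have nz: "\<gamma> t \<noteq> 0" "\<gamma> t \<noteq> 1" "\<gamma> t * y \<noteq> 1" if "t \<in> {0..1}" for t
        using \<gamma>[OF that] y by (simp_all add: eq_divide_eq)
      have eq: "1 - p * y + of_real t * - (b * y) = 1 - \<gamma> t * y" for t
        by (simp add: \<gamma>_def algebra_simps)
      \<comment> \<open>The first two moving arguments are affine in t; they count as quotients with
        denominator 1 + t * 0.\<close>
      have one: "1 + of_real t * 0 \<noteq> (0 :: complex)" for t :: real by simp
      note N = has_real_derivative_bloch_wigner_moebius[OF one]
      have simps: "1 + of_real t * 0 = (1 :: complex)" "c * 1 - a * 0 = c" "c / 1\<^sup>2 = c" "c / 1 = c"
        for t :: real and a c :: complex by auto
      obtain k1 where k1: "finite k1" "\<And>t. t \<in> {0<..<1} - k1 \<Longrightarrow>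
          ((\<lambda>t. bloch_wigner (\<gamma> t)) has_real_derivative dilog_form (\<gamma> t) b) (at t)"
        by (rule N[of p b, unfolded simps, folded \<gamma>_def]) (rule that)
      obtain k2 where k2: "finite k2" "\<And>t. t \<in> {0<..<1} - k2 \<Longrightarrow>
          ((\<lambda>t. bloch_wigner (1 - \<gamma> t * y)) has_real_derivative
             dilog_form (1 - \<gamma> t * y) (- (b * y))) (at t)"
        by (rule N[of "1 - p * y" "- (b * y)", unfolded simps eq]) (rule that)
      have "1 - p * y + of_real t * - (b * y) \<noteq> 0" if "t \<in> {0..1}" for t
        using nz[OF that] unfolding eq by simp
      note M = has_real_derivative_bloch_wigner_moebius[OF this, unfolded eq]
      have e3: "1 - p + of_real t * - b = 1 - \<gamma> t" for t
        by (simp add: \<gamma>_def algebra_simps)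
      have n3: "- b * (1 - p * y) - (1 - p) * - (b * y) = b * (y - 1)" by (simp add: algebra_simps)
      obtain k3 where k3: "finite k3" "\<And>t. t \<in> {0<..<1} - k3 \<Longrightarrow>
          ((\<lambda>t. bloch_wigner ((1 - \<gamma> t) / (1 - \<gamma> t * y))) has_real_derivative
             dilog_form ((1 - \<gamma> t) / (1 - \<gamma> t * y)) (b * (y - 1) / (1 - \<gamma> t * y)\<^sup>2)) (at t)"
        by (rule M[of "1 - p" "- b", unfolded e3 n3], assumption) (rule that)
      have n4: "0 * (1 - p * y) - (1 - y) * - (b * y) = b * y * (1 - y)" by (simp add: algebra_simps)
      have e4: "1 - y + of_real t * 0 = 1 - y" for t :: real by simp
      obtain k4 where k4: "finite k4" "\<And>t. t \<in> {0<..<1} - k4 \<Longrightarrow>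
          ((\<lambda>t. bloch_wigner ((1 - y) / (1 - \<gamma> t * y))) has_real_derivative
             dilog_form ((1 - y) / (1 - \<gamma> t * y)) (b * y * (1 - y) / (1 - \<gamma> t * y)\<^sup>2)) (at t)"
        by (rule M[of "1 - y" 0, unfolded e4 n4], assumption) (rule that)
      define k where "k = k1 \<union> k2 \<union> k3 \<union> k4 \<union> {0, 1}"
      have "five_term (\<gamma> 1) y = five_term p y"
      proof (rule has_derivative_zero_unique_strong_interval[where f = "\<lambda>t. five_term (\<gamma> t) y"])
        show "finite k" by (simp add: k_def k1 k2 k3 k4)
        show "continuous_on {0..1} (\<lambda>t. five_term (\<gamma> t) y)"
          by (rule continuous_on_compose2[OF continuous_on_five_term[OF y]])
             (use \<gamma> in \<open>auto simp: \<gamma>_def intro!: continuous_intros\<close>)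
        show "five_term (\<gamma> 0) y = five_term p y" by (simp add: \<gamma>_def)
        fix t assume t: "t \<in> {0..1} - k"
        then have t': "t \<in> {0<..<1} - k1" "t \<in> {0<..<1} - k2" "t \<in> {0<..<1} - k3"
            "t \<in> {0<..<1} - k4" "t \<in> {0..1}"
          by (auto simp: k_def)
        \<comment> \<open>The summand 0 belongs to the constant argument y.\<close>
        have "((\<lambda>t. five_term (\<gamma> t) y) has_real_derivative
            dilog_form (\<gamma> t) b + 0 + dilog_form (1 - \<gamma> t * y) (- (b * y))
            + dilog_form ((1 - \<gamma> t) / (1 - \<gamma> t * y)) (b * (y - 1) / (1 - \<gamma> t * y)\<^sup>2)
            + dilog_form ((1 - y) / (1 - \<gamma> t * y)) (b * y * (1 - y) / (1 - \<gamma> t * y)\<^sup>2)) (at t)"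
          unfolding five_term_def
          by (intro DERIV_add DERIV_const k1 k2 k3 k4 t')
        then have "((\<lambda>t. five_term (\<gamma> t) y) has_real_derivative 0) (at t)"
          using dilog_form_five_term[OF nz(1,2)[OF t'(5)] y nz(3)[OF t'(5)], of b] by simp
        then show "((\<lambda>t. five_term (\<gamma> t) y) has_derivative (\<lambda>h. 0)) (at t within {0..1})"
          unfolding has_field_derivative_def lambda_zero[symmetric] by (rule has_derivative_at_withinI)
      qed auto
      then show ?thesis by (simp add: \<gamma>_def b_def)
    qed
    show "\<forall>\<^sub>F q in at p within - {0, 1, 1 / y}. five_term p y = five_term q y"
      unfolding eventually_at using e(1) const
      by (intro exI[of _ e]) (metis dist_commute mem_ball)
  qed
qed

lemma five_term_commute: "five_term x y = five_term y x"
  by (simp add: five_term_def mult.commute)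

lemma five_term_relation:
  assumes "x \<noteq> 0" "x \<noteq> 1" "y \<noteq> 0" "y \<noteq> 1" "x * y \<noteq> 1"
  shows "five_term x y = 0"
proof -
  \<comment> \<open>Move \<open>x\<close>, and then \<open>y\<close>, to a real point; there all five terms vanish.\<close>
  obtain r :: complex where r: "r \<in> {2, 3}" "r \<noteq> 1 / y" "r \<noteq> 1 / r"
  proof (cases "1 / y = 2")
    case True
    then show ?thesis by (intro that[of 3]) auto
  next
    case False
    then show ?thesis by (intro that[of 2]) auto
  qed
  have "five_term x y = five_term r y"
    by (rule five_term_constant) (use assms r in \<open>auto simp: eq_divide_eq mult.commute\<close>)
  also have "\<dots> = five_term y r" by (rule five_term_commute)
  also have "\<dots> = five_term r r"
    by (rule five_term_constant) (use assms r in \<open>auto simp: eq_divide_eq mult.commute\<close>)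
  also have "\<dots> = 0"
    using r by (auto simp: five_term_def bloch_wigner_real)
  finally show ?thesis .
qed

text \<open>Here arg w is pi/3 up to sign, so the value is that of Cl_2 at 2 pi/3 up to sign. Moving
  horizontally to the imaginary axis leads to Cl_2(pi) = 0. On the way |g|^2 < 1 < 3 = |2 Im g|^2,
  so the logarithm in the derivative stays positive, and the mean value theorem excludes the value 0
  at the start.\<close>

lemma clausen_arg_nonzero:
  assumes "w\<^sup>2 - w + 1 = 0"
  shows "clausen_arg w \<noteq> 0"
proof -
  define s where "s = Im w"
  have re: "Re w = 1 / 2" and s: "s\<^sup>2 = 3 / 4"
  proof -
    have 1: "(2 * Re w - 1) * s = 0" and 2: "(Re w)\<^sup>2 - s\<^sup>2 - Re w + 1 = 0"
      using assms by (auto simp: complex_eq_iff power2_eq_square s_def algebra_simps)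
    have "s \<noteq> 0"
    proof
      assume "s = 0"
      have "(Re w - 1 / 2)\<^sup>2 = (Re w)\<^sup>2 - Re w + 1 / 4"
        by (simp add: power2_eq_square algebra_simps)
      then show False using 2 \<open>s = 0\<close> zero_le_power2[of "Re w - 1 / 2"] by simp
    qed
    then show "Re w = 1 / 2" using 1 by simp
    with 2 show "s\<^sup>2 = 3 / 4" by (simp add: power2_eq_square)
  qed
  define g where "g t = Complex (1 / 2 * (1 - t)) s" for t
  have g: "(g has_vector_derivative Complex (- 1 / 2) 0) (at t)" for t
  proof -
    have "g = (\<lambda>t. Complex (1 / 2) s + t *\<^sub>R Complex (- 1 / 2) 0)"
      by (auto simp: g_def complex_eq_iff)
    then show ?thesis by (auto intro!: derivative_eq_intros)
  qed
  have sn: "s \<noteq> 0" using s by auto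
  define g' where "g' t = - s / (cmod (g t))\<^sup>2 * (ln \<bar>2 * s\<bar> - ln (cmod (g t)))" for t
  have D: "((\<lambda>t. clausen_arg (g t)) has_real_derivative g' t) (at t)" for t
  proof -
    have "Im (Complex (- 1 / 2) 0 / g t) = (s / 2) / (cmod (g t))\<^sup>2"
      by (simp add: Im_divide cmod_power2) (simp add: g_def)
    then have "- 2 * Im (Complex (- 1 / 2) 0 / g t) = - s / (cmod (g t))\<^sup>2"
      by simp
    then show ?thesis
      using has_real_derivative_clausen_arg[OF g[of t]] sn by (simp add: g_def g'_def)
  qed
  have "\<exists>t. 0 < t \<and> t < 1 \<and> clausen_arg (g 1) - clausen_arg (g 0) = (1 - 0) * g' t"
    by (rule MVT2) (use D in auto)
  then obtain t where t: "0 < t" "t < 1" "clausen_arg (g 1) - clausen_arg (g 0) = g' t"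
    by auto
  have "g 0 = w" using re by (simp add: g_def s_def complex_eq_iff)
  moreover have "clausen_arg (g 1) = 0"
  proof -
    have "g 1 / cnj (g 1) = -1"
      using sn by (simp add: g_def complex_eq_iff Re_divide Im_divide power2_eq_square)
    then have "clausen_arg (g 1) = Im (li2 (-1))" by (simp add: clausen_arg_def)
    moreover have "cnj (li2 (-1)) = li2 (-1)" using li2_cnj[of "-1"] by simp
    ultimately show ?thesis by (simp add: complex_eq_iff)
  qed
  moreover have "g' t \<noteq> 0"
  proof -
    have "(cmod (g t))\<^sup>2 = (1 / 2 * (1 - t))\<^sup>2 + s\<^sup>2" by (simp add: g_def cmod_power2)
    also have "\<dots> < (1 / 2)\<^sup>2 + s\<^sup>2"
      using t by (intro add_strict_right_mono power_strict_mono) auto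
    also have "\<dots> < \<bar>2 * s\<bar>\<^sup>2" using s by (simp add: power2_eq_square field_simps)
    finally have "cmod (g t) < \<bar>2 * s\<bar>" by (rule power_less_imp_less_base) simp
    moreover have "g t \<noteq> 0" using sn by (auto simp: g_def complex_eq_iff)
    ultimately have "ln (cmod (g t)) < ln \<bar>2 * s\<bar>" by (intro ln_less_cancel_iff[THEN iffD2]) auto
    then show ?thesis using sn \<open>g t \<noteq> 0\<close> by (auto simp: g'_def)
  qed
  ultimately show ?thesis using t by simp
qed

text \<open>The triangle 0, 1, w is equilateral: w is fixed under z -> 1/(1 - z) and z -> 1 - 1/z,
  so the three angle terms coincide.\<close>

lemma bloch_wigner_nonzero:
  assumes w: "w\<^sup>2 - w + 1 = 0"
  shows "bloch_wigner w \<noteq> 0"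
proof -
  have w0: "w \<noteq> 0" "w \<noteq> 1" using w by auto
  have "w - w\<^sup>2 = 1" using w by (simp add: algebra_simps eq_neg_iff_add_eq_0)
  then have "w * (1 - w) = 1" by (simp add: right_diff_distrib power2_eq_square)
  then have "1 / w = 1 - w" "1 / (1 - w) = w"
    using w0 by (simp_all add: nonzero_divide_eq_eq mult.commute)
  then have "1 - 1 / w = w" "1 / (1 - w) = w" by simp_all
  then have "bloch_wigner w = 3 * clausen_arg w" by (simp add: bloch_wigner_def)
  then show ?thesis using clausen_arg_nonzero[OF w] by simp
qed

section \<open>Computing in the Bloch group\<close>

lemma vector_4 [simp]:
  fixes w x y z :: "'a::zero"
  shows "(vector [w, x, y, z] :: 'a^4) $ 1 = w"
    "(vector [w, x, y, z] :: 'a^4) $ 2 = x"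
    "(vector [w, x, y, z] :: 'a^4) $ 3 = y"
    "(vector [w, x, y, z] :: 'a^4) $ 4 = z"
  by (simp_all add: vector_def)

locale field_closed =
  fixes K :: "'a::field set"
  assumes one_closed: "1 \<in> K"
    and add_closed: "x \<in> K \<Longrightarrow> y \<in> K \<Longrightarrow> x + y \<in> K"
    and uminus_closed: "x \<in> K \<Longrightarrow> - x \<in> K"
    and mult_closed: "x \<in> K \<Longrightarrow> y \<in> K \<Longrightarrow> x * y \<in> K"
    and inverse_closed: "x \<in> K \<Longrightarrow> inverse x \<in> K"
begin

lemma diff_closed: "x \<in> K \<Longrightarrow> y \<in> K \<Longrightarrow> x - y \<in> K"
  using add_closed[of x "- y"] uminus_closed[of y] by simp

lemma divide_closed: "x \<in> K \<Longrightarrow> y \<in> K \<Longrightarrow> x / y \<in> K"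
  by (simp add: divide_inverse mult_closed inverse_closed)

end

lemma field_closed_generate_field:
  "field_closed (generate_field ring_of_type_algebra (H :: 'a::field set))"
proof -
  interpret R: field "ring_of_type_algebra :: 'a ring" by (rule field_from_type_algebra)
  have R: "carrier (ring_of_type_algebra :: 'a ring) = UNIV"
    "x \<otimes>\<^bsub>ring_of_type_algebra\<^esub> y = x * y" "x \<oplus>\<^bsub>ring_of_type_algebra\<^esub> y = x + y"
    "\<one>\<^bsub>ring_of_type_algebra\<^esub> = (1::'a)" "\<zero>\<^bsub>ring_of_type_algebra\<^esub> = (0::'a)" for x y :: 'a
    by (simp_all add: ring_of_type_algebra_def)
  have minus: "\<ominus>\<^bsub>ring_of_type_algebra\<^esub> x = - x" for x :: 'a
    by (rule R.minus_equality) (simp_all add: R)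
  have inv: "inv\<^bsub>ring_of_type_algebra\<^esub> x = inverse x" if "x \<noteq> 0" for x :: 'a
    by (rule R.comm_inv_char) (simp_all add: R that)
  let ?K = "generate_field ring_of_type_algebra H"
  show ?thesis
  proof
    show 1: "1 \<in> ?K" using generate_field.one[of ring_of_type_algebra H] by (simp add: R)
    show add: "x + y \<in> ?K" if "x \<in> ?K" "y \<in> ?K" for x y
      using generate_field.eng_add[OF that] by (simp add: R)
    show "x * y \<in> ?K" if "x \<in> ?K" "y \<in> ?K" for x y
      using generate_field.eng_mult[OF that] by (simp add: R)
    show neg: "- x \<in> ?K" if "x \<in> ?K" for x
      using generate_field.a_inv[OF that] by (simp add: minus)
    show "inverse x \<in> ?K" if "x \<in> ?K" for x
    \<comment> \<open>\<open>generate_field\<close> inverts only nonzero elements, while here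
      \<open>inverse 0 = 0\<close> also has to be a member; 0 is reached as 1 + (-1).\<close>
    proof (cases "x = 0")
      case True
      then show ?thesis using add[OF 1 neg[OF 1]] by simp
    next
      case False
      then show ?thesis using generate_field.m_inv[OF that] by (simp add: R inv)
    qed
  qed
qed

lemma subgroup_free_Abelian_group_diff:
  assumes "subgroup H (free_Abelian_group S)" "x \<in> H" "y \<in> H"
  shows "x - y \<in> H"
proof -
  have "x + (- y) \<in> H"
    using subgroup.m_closed[OF assms(1,2) subgroup.m_inv_closed[OF assms(1,3)]]
      subgroup.mem_carrier[OF assms(1,3)] by simp
  then show ?thesis by simp
qed

lemma subgroup_free_Abelian_group_add:
  assumes "subgroup H (free_Abelian_group S)" "x \<in> H" "y \<in> H"
  shows "x + y \<in> H"
  using subgroup.m_closed[OF assms] by simp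

lemma subgroup_free_Abelian_group_zero:
  assumes "subgroup H (free_Abelian_group S)"
  shows "0 \<in> H"
  using subgroup.one_closed[OF assms] by simp

lemma keys_frag_of_add_subset:
  "Poly_Mapping.keys (frag_of x) \<subseteq> S \<longleftrightarrow> x \<in> S"
  "Poly_Mapping.keys a \<subseteq> S \<Longrightarrow> Poly_Mapping.keys b \<subseteq> S \<Longrightarrow> Poly_Mapping.keys (a + b) \<subseteq> S"
  "Poly_Mapping.keys a \<subseteq> S \<Longrightarrow> Poly_Mapping.keys b \<subseteq> S \<Longrightarrow> Poly_Mapping.keys (a - b) \<subseteq> S"
  using keys_add[of a b] keys_diff[of a b] by auto

context field_closed
begin

lemma wedge_relations_subgroup: "subgroup (wedge_relations K) (wedge_free K)"
  unfolding wedge_relations_def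
proof (rule group.generate_is_subgroup, goal_cases)
  case 2
  show ?case
    by (intro Un_least subsetI; elim CollectE exE conjE)
       (simp_all only: wedge_free_def carrier_free_Abelian_group_iff,
         (intro keys_frag_of_add_subset(3) keys_frag_of_add_subset(1)[THEN iffD2]; simp add: mult_closed)+)
qed (simp add: wedge_free_def)

lemmas wedge_subgroup = wedge_relations_subgroup[unfolded wedge_free_def]

lemma wedge_mult_right:
  assumes "x \<in> K - {0}" "y \<in> K - {0}" "z \<in> K - {0}"
  shows "frag_of (x, y * z) - frag_of (x, y) - frag_of (x, z) \<in> wedge_relations K"
  unfolding wedge_relations_def by (rule generate.incl) (use assms in blast)

lemma wedge_mult_left:
  assumes "x \<in> K - {0}" "y \<in> K - {0}" "z \<in> K - {0}"
  shows "frag_of (x * y, z) - frag_of (x, z) - frag_of (y, z) \<in> wedge_relations K"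
  unfolding wedge_relations_def by (rule generate.incl) (use assms in blast)

lemma wedge_self:
  assumes "x \<in> K - {0}"
  shows "frag_of (x, x) \<in> wedge_relations K"
  unfolding wedge_relations_def by (rule generate.incl) (use assms in blast)

text \<open>Polarization: expand (x y) \<and> (x y) by bilinearity and remove x \<and> x and y
  \<and> y.\<close>

lemma wedge_antisym:
  assumes "x \<in> K - {0}" "y \<in> K - {0}"
  shows "frag_of (x, y) + frag_of (y, x) \<in> wedge_relations K"
proof -
  note W = subgroup_free_Abelian_group_add[OF wedge_subgroup]
    subgroup_free_Abelian_group_diff[OF wedge_subgroup]
  have xy: "x * y \<in> K - {0}" using assms by (auto simp: mult_closed)
  have "frag_of (x * y, x * y) - (frag_of (x * y, x * y) - frag_of (x, x * y) - frag_of (y, x * y))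
      - (frag_of (x, x * y) - frag_of (x, x) - frag_of (x, y))
      - (frag_of (y, x * y) - frag_of (y, x) - frag_of (y, y))
      - frag_of (x, x) - frag_of (y, y) \<in> wedge_relations K"
    using assms xy by (intro W wedge_self wedge_mult_right wedge_mult_left)
  then show ?thesis by simp
qed

lemma wedge_mult_self:
  assumes "x \<in> K - {0}" "y \<in> K - {0}"
  shows "frag_of (x, x * y) - frag_of (x, y) \<in> wedge_relations K"
  using subgroup_free_Abelian_group_add[OF wedge_subgroup
      wedge_mult_right[OF assms(1,1,2)] wedge_self[OF assms(1)]] by simp

text \<open>The symmetry of the exponent matrix enters here. Diagonal exponents contribute multiples
  of x \<and> x, and the off-diagonal ones pair up as x \<and> y + y \<and> x. The powers are
  written as nested products so that \<open>wedge_mult_self\<close> can strip one factor at a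
  time.\<close>

lemma wedge_nahm:
  assumes K: "a \<in> K - {0}" "b \<in> K - {0}" "c \<in> K - {0}" "d \<in> K - {0}"
    and eqs: "1 - a = a * (a * (a * (b * c)))" "1 - b = b * (b * (b * (a * d)))"
      "1 - c = c * a" "1 - d = d * b"
  shows "frag_of (a, 1 - a) + frag_of (b, 1 - b) + frag_of (c, 1 - c) + frag_of (d, 1 - d)
    \<in> wedge_relations K"
proof -
  note W = subgroup_free_Abelian_group_add[OF wedge_subgroup]
  have cube: "frag_of (x, x * (x * (x * (y * z)))) - frag_of (x, y) - frag_of (x, z) \<in> wedge_relations K"
    if "x \<in> K - {0}" "y \<in> K - {0}" "z \<in> K - {0}" for x y z
  proof -
    have K: "y * z \<in> K - {0}" "x * (y * z) \<in> K - {0}" "x * (x * (y * z)) \<in> K - {0}"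
      using that by (auto simp: mult_closed)
    have "(frag_of (x, x * (x * (x * (y * z)))) - frag_of (x, x * (x * (y * z))))
        + (frag_of (x, x * (x * (y * z))) - frag_of (x, x * (y * z)))
        + (frag_of (x, x * (y * z)) - frag_of (x, y * z))
        + (frag_of (x, y * z) - frag_of (x, y) - frag_of (x, z)) \<in> wedge_relations K"
      using that K by (intro W wedge_mult_self wedge_mult_right)
    then show ?thesis by (simp add: algebra_simps)
  qed
  have "(frag_of (a, 1 - a) - frag_of (a, b) - frag_of (a, c))
      + (frag_of (b, 1 - b) - frag_of (b, a) - frag_of (b, d))
      + (frag_of (c, 1 - c) - frag_of (c, a)) + (frag_of (d, 1 - d) - frag_of (d, b))
      + (frag_of (a, b) + frag_of (b, a)) + (frag_of (a, c) + frag_of (c, a))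
      + (frag_of (b, d) + frag_of (d, b)) \<in> wedge_relations K"
    unfolding eqs using K by (intro W cube wedge_mult_self wedge_antisym)
  then show ?thesis by (simp add: algebra_simps)
qed

lemma bloch_relations_subgroup: "subgroup (bloch_relations K) (free_Abelian_group (K - {0, 1}))"
proof -
  have K: "1 - x \<in> K - {0, 1}" "1 / x \<in> K - {0, 1}" if "x \<in> K - {0, 1}" for x
    using that by (auto simp: diff_closed divide_closed one_closed)
  have 5: "1 - x * y \<in> K - {0, 1}" "(1 - x) / (1 - x * y) \<in> K - {0, 1}"
    "(1 - y) / (1 - x * y) \<in> K - {0, 1}"
    if "x \<in> K - {0, 1}" "y \<in> K - {0, 1}" "x * y \<noteq> 1" for x y
    using that five_term_arguments[of x y] by (simp_all add: diff_closed divide_closed one_closed mult_closed)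
  show ?thesis
    unfolding bloch_relations_def
  proof (rule group.generate_is_subgroup, goal_cases)
    case 2
    show ?case
      by (intro Un_least subsetI; elim CollectE exE conjE)
         (simp_all only: carrier_free_Abelian_group_iff,
           (intro keys_frag_of_add_subset(2) keys_frag_of_add_subset(1)[THEN iffD2] K 5; blast)+)
  qed simp
qed

lemma bloch_one_minus:
  assumes "x \<in> K - {0, 1}"
  shows "frag_of x + frag_of (1 - x) \<in> bloch_relations K"
  unfolding bloch_relations_def by (rule generate.incl) (use assms in blast)

lemma bloch_five_term:
  assumes "x \<in> K - {0, 1}" "y \<in> K - {0, 1}" "x * y \<noteq> 1"
  shows "frag_of x + frag_of y + frag_of (1 - x * y)
         + frag_of ((1 - x) / (1 - x * y)) + frag_of ((1 - y) / (1 - x * y)) \<in> bloch_relations K"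
  unfolding bloch_relations_def by (rule generate.incl) (use assms in blast)

lemma comm_group_wedge_square: "comm_group (wedge_square K)"
  unfolding wedge_square_def using wedge_relations_subgroup
  by (intro comm_group.abelian_FactGroup) (simp_all add: wedge_free_def abelian_free_Abelian_group)

text \<open>For the elements considered here the wedge already vanishes before torsion is divided
  out, which is a condition on the free group alone.\<close>

lemma bloch_kernelI:
  assumes keys: "Poly_Mapping.keys \<xi> \<subseteq> K - {0, 1}"
    and w: "frag_extend (\<lambda>x. frag_of (x, 1 - x)) \<xi> \<in> wedge_relations K"
  shows "\<xi> \<in> carrier (bloch_kernel K)"
proof -
  interpret W: comm_group "wedge_square K" by (rule comm_group_wedge_square)
  interpret F: group "wedge_free K" by (simp add: wedge_free_def)
  let ?w = "frag_extend (\<lambda>x. frag_of (x, 1 - x)) \<xi>"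
  have "wedge_relations K #>\<^bsub>wedge_free K\<^esub> ?w = wedge_relations K"
    using w wedge_relations_subgroup by (intro F.coset_join2) (auto dest: subgroup.mem_carrier)
  also have "\<dots> = \<one>\<^bsub>wedge_square K\<^esub>" by (simp add: wedge_square_def)
  also have "torsion_elements (wedge_square K) #>\<^bsub>wedge_square K\<^esub> \<one>\<^bsub>wedge_square K\<^esub>
      = torsion_elements (wedge_square K)"
    by (rule W.coset_mult_one) (auto simp: torsion_elements_def)
  finally show ?thesis
    using keys by (simp add: bloch_kernel_def kernel_def bloch_map_def wedge_square_mod_torsion_def)
qed

lemma bloch_coset_eq: "bloch_relations K #>\<^bsub>bloch_kernel K\<^esub> \<xi> = (\<lambda>r. r + \<xi>) ` bloch_relations K"
  by (auto simp: r_coset_def bloch_kernel_def)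

text \<open>The product in a factor group is the set product of cosets, so the power is computed on
  translates of the subgroup of relations.\<close>

lemma bloch_group_pow:
  "(bloch_relations K #>\<^bsub>bloch_kernel K\<^esub> \<xi>) [^]\<^bsub>bloch_group K\<^esub> (n::nat)
   = bloch_relations K #>\<^bsub>bloch_kernel K\<^esub> frag_cmul (int n) \<xi>"
proof (induction n)
  case 0
  show ?case by (simp add: bloch_group_def bloch_coset_eq nat_pow_def)
next
  case (Suc n)
  note R = bloch_relations_subgroup
  have "(\<lambda>r. r + \<xi>) ` bloch_relations K <#>\<^bsub>bloch_kernel K\<^esub> (\<lambda>r. r + \<xi>') ` bloch_relations K
      = (\<lambda>r. r + (\<xi> + \<xi>')) ` bloch_relations K" for \<xi> \<xi>'
  proof (intro equalityI subsetI)
    fix z assume "z \<in> (\<lambda>r. r + \<xi>) ` bloch_relations K <#>\<^bsub>bloch_kernel K\<^esub> (\<lambda>r. r + \<xi>') ` bloch_relations K"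
    then obtain r s where "r \<in> bloch_relations K" "s \<in> bloch_relations K" "z = (r + s) + (\<xi> + \<xi>')"
      by (auto simp: set_mult_def bloch_kernel_def algebra_simps)
    then show "z \<in> (\<lambda>r. r + (\<xi> + \<xi>')) ` bloch_relations K"
      using subgroup_free_Abelian_group_add[OF R] by blast
  next
    fix z assume "z \<in> (\<lambda>r. r + (\<xi> + \<xi>')) ` bloch_relations K"
    then obtain r where "r \<in> bloch_relations K" "z = (r + \<xi>) + (0 + \<xi>')" by (auto simp: algebra_simps)
    then show "z \<in> (\<lambda>r. r + \<xi>) ` bloch_relations K <#>\<^bsub>bloch_kernel K\<^esub> (\<lambda>r. r + \<xi>') ` bloch_relations K"
      using subgroup_free_Abelian_group_zero[OF R]
      unfolding set_mult_def bloch_kernel_def by (auto intro!: bexI imageI)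
  qed
  moreover have "frag_cmul (int (Suc n)) \<xi> = frag_cmul (int n) \<xi> + \<xi>"
    by (simp add: frag_cmul_distrib add.commute)
  ultimately show ?case
    using Suc by (simp only: bloch_group_def bloch_coset_eq nat_pow_def mult_FactGroup old.nat.simps)
qed

lemma bloch_coset_carrier:
  assumes "\<xi> \<in> carrier (bloch_kernel K)"
  shows "bloch_relations K #>\<^bsub>bloch_kernel K\<^esub> \<xi> \<in> carrier (bloch_group K)"
  using assms by (auto simp: bloch_group_def carrier_FactGroup)

text \<open>Both halves of (c) pass through this criterion: for the first type a multiple is
  exhibited among the relations, for the second a real-valued homomorphism that kills the relations
  rules out every multiple.\<close>

lemma bloch_coset_torsion_iff:
  assumes "\<xi> \<in> carrier (bloch_kernel K)"
  shows "bloch_relations K #>\<^bsub>bloch_kernel K\<^esub> \<xi> \<in> torsion_elements (bloch_group K) \<longleftrightarrow>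
    (\<exists>n::nat. n > 0 \<and> frag_cmul (int n) \<xi> \<in> bloch_relations K)"
proof -
  note R = bloch_relations_subgroup
  have "(\<lambda>r. r + \<zeta>) ` bloch_relations K = bloch_relations K \<longleftrightarrow> \<zeta> \<in> bloch_relations K" for \<zeta>
  proof
    assume "(\<lambda>r. r + \<zeta>) ` bloch_relations K = bloch_relations K"
    then have "0 + \<zeta> \<in> bloch_relations K"
      using subgroup_free_Abelian_group_zero[OF R] by blast
    then show "\<zeta> \<in> bloch_relations K" by simp
  next
    assume z: "\<zeta> \<in> bloch_relations K"
    have "r \<in> (\<lambda>r. r + \<zeta>) ` bloch_relations K" if "r \<in> bloch_relations K" for r
      using subgroup_free_Abelian_group_diff[OF R that z] by (intro image_eqI[of _ _ "r - \<zeta>"]) auto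
    then show "(\<lambda>r. r + \<zeta>) ` bloch_relations K = bloch_relations K"
      using subgroup_free_Abelian_group_add[OF R _ z] by auto
  qed
  then show ?thesis
    using bloch_coset_carrier[OF assms]
    by (simp add: torsion_elements_def bloch_group_pow) (simp add: bloch_coset_eq bloch_group_def)
qed

end

lemma subgroup_free_Abelian_group_cmul:
  assumes "subgroup H (free_Abelian_group S)" "x \<in> H"
  shows "frag_cmul (int n) x \<in> H"
proof (induction n)
  case 0
  show ?case using subgroup_free_Abelian_group_zero[OF assms(1)] by simp
next
  case (Suc n)
  then show ?case
    using subgroup_free_Abelian_group_add[OF assms(1) assms(2) Suc] by (simp add: frag_cmul_distrib)
qed

section \<open>The homomorphism given by the Bloch--Wigner function\<close>

definition bloch_wigner_hom :: "(complex \<Rightarrow>\<^sub>0 int) \<Rightarrow> real" where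
  "bloch_wigner_hom \<xi> =
     (\<Sum>x\<in>Poly_Mapping.keys \<xi>. of_int (Poly_Mapping.lookup \<xi> x) * bloch_wigner x)"

lemma bloch_wigner_hom_superset:
  assumes "finite S" "Poly_Mapping.keys \<xi> \<subseteq> S"
  shows "bloch_wigner_hom \<xi> = (\<Sum>x\<in>S. of_int (Poly_Mapping.lookup \<xi> x) * bloch_wigner x)"
  unfolding bloch_wigner_hom_def
  by (rule sum.mono_neutral_left) (use assms in \<open>auto simp: in_keys_iff\<close>)

lemma bloch_wigner_hom_add: "bloch_wigner_hom (a + b) = bloch_wigner_hom a + bloch_wigner_hom b"
proof -
  let ?S = "Poly_Mapping.keys a \<union> Poly_Mapping.keys b"
  have "bloch_wigner_hom (a + b) = (\<Sum>x\<in>?S. of_int (Poly_Mapping.lookup (a + b) x) * bloch_wigner x)"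
    by (rule bloch_wigner_hom_superset) (use keys_add[of a b] in auto)
  also have "\<dots> = (\<Sum>x\<in>?S. of_int (Poly_Mapping.lookup a x) * bloch_wigner x)
      + (\<Sum>x\<in>?S. of_int (Poly_Mapping.lookup b x) * bloch_wigner x)"
    by (simp add: lookup_add algebra_simps flip: sum.distrib)
  also have "\<dots> = bloch_wigner_hom a + bloch_wigner_hom b"
    by (intro arg_cong2[of _ _ _ _ "(+)"] bloch_wigner_hom_superset[symmetric]) auto
  finally show ?thesis .
qed

lemma bloch_wigner_hom_zero: "bloch_wigner_hom 0 = 0"
  by (simp add: bloch_wigner_hom_def)

lemma bloch_wigner_hom_of: "bloch_wigner_hom (frag_of x) = bloch_wigner x"
  by (simp add: bloch_wigner_hom_def)

lemma bloch_wigner_hom_uminus: "bloch_wigner_hom (- a) = - bloch_wigner_hom a"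
  using bloch_wigner_hom_add[of a "- a"] by (simp add: bloch_wigner_hom_zero)

lemma bloch_wigner_hom_cmul: "bloch_wigner_hom (frag_cmul (int n) a) = real n * bloch_wigner_hom a"
  by (induction n) (simp_all add: bloch_wigner_hom_zero frag_cmul_distrib bloch_wigner_hom_add algebra_simps)

lemma bloch_wigner_hom_generator:
  assumes "\<xi> \<in> {frag_of x + frag_of (1 - x) | x. x \<in> K - {0, 1}} \<union>
      {frag_of x + frag_of (1 / x) | x. x \<in> K - {0, 1}} \<union>
      {frag_of x + frag_of y + frag_of (1 - x * y)
         + frag_of ((1 - x) / (1 - x * y)) + frag_of ((1 - y) / (1 - x * y)) | x y.
         x \<in> K - {0, 1} \<and> y \<in> K - {0, 1} \<and> x * y \<noteq> 1}"
  shows "bloch_wigner_hom \<xi> = 0"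
  using assms five_term_relation
  by (auto simp: bloch_wigner_hom_add bloch_wigner_hom_of bloch_wigner_one_minus
      bloch_wigner_inverse five_term_def)

lemma bloch_wigner_hom_relations:
  assumes "field_closed K" and "\<xi> \<in> bloch_relations K"
  shows "bloch_wigner_hom \<xi> = 0"
proof -
  interpret field_closed K by fact
  let ?G = "free_Abelian_group (K - {0, 1})"
  have sub: "Poly_Mapping.keys \<xi> \<subseteq> K - {0, 1}" if "\<xi> \<in> bloch_relations K" for \<xi>
    using subgroup.mem_carrier[OF bloch_relations_subgroup that] by simp
  from assms(2) show ?thesis
    unfolding bloch_relations_def
  proof (induction rule: generate.induct)
    case (inv h)
    \<comment> \<open>The group inverse is known to be negation only on the carrier, so the support
      of the generator has to be located first.\<close>
    have "Poly_Mapping.keys h \<subseteq> K - {0, 1}"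
      using generate.incl[OF inv] by (intro sub) (simp only: bloch_relations_def)
    then show ?case
      using bloch_wigner_hom_generator[OF inv] by (simp add: bloch_wigner_hom_uminus)
  qed (simp_all only: bloch_wigner_hom_generator mult_free_Abelian_group one_free_Abelian_group
      bloch_wigner_hom_add bloch_wigner_hom_zero add_0)
qed

lemma frag_sum_bloch_kernel:
  assumes "field_closed K" and K: "a \<in> K - {0, 1}" "b \<in> K - {0, 1}" "c \<in> K - {0, 1}" "d \<in> K - {0, 1}"
    and eqs: "1 - a = a * (a * (a * (b * c)))" "1 - b = b * (b * (b * (a * d)))"
      "1 - c = c * a" "1 - d = d * b"
  shows "frag_of a + frag_of b + frag_of c + frag_of d \<in> carrier (bloch_kernel K)"
proof -
  interpret field_closed K by fact
  show ?thesis
  proof (rule bloch_kernelI)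
    show "Poly_Mapping.keys (frag_of a + frag_of b + frag_of c + frag_of d) \<subseteq> K - {0, 1}"
      using K by (intro keys_frag_of_add_subset(2) keys_frag_of_add_subset(1)[THEN iffD2])
    show "frag_extend (\<lambda>x. frag_of (x, 1 - x)) (frag_of a + frag_of b + frag_of c + frag_of d)
        \<in> wedge_relations K"
      using wedge_nahm[OF _ _ _ _ eqs] K by (simp add: frag_extend_add)
  qed
qed

lemma coordinate_field_closed: "field_closed (coordinate_field Q)"
  unfolding coordinate_field_def by (rule field_closed_generate_field)

lemma coordinate_field_incl: "Q $ i \<in> coordinate_field Q"
  unfolding coordinate_field_def by (rule generate_field.incl) simp

section \<open>The classes of the two types of solutions\<close>

lemma bloch_class_first_type:
  assumes u: "1 - u ^ 2 = u ^ 4"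
  defines "Q \<equiv> vector [u, u, 1 / (1 + u), 1 / (1 + u)] :: complex^4"
  shows "bloch_class Q \<in> torsion_elements (bloch_group (coordinate_field Q))"
proof -
  define K where "K = coordinate_field Q"
  interpret field_closed K unfolding K_def by (rule coordinate_field_closed)
  define s v where "s = 1 / (1 + u)" and "v = u * u"
  have Q: "Q = vector [u, u, s, s]" by (simp add: Q_def s_def)
  have u0: "u \<noteq> 0" "u \<noteq> 1" "u \<noteq> -1" using u by auto
  have vv: "1 - v = v * v" using u by (simp add: v_def power2_eq_square power4_eq_xxxx)
  have u1: "1 + u \<noteq> 0" using u0(3) by (simp add: add_eq_0_iff)
  have su: "s * (1 + u) = 1" using u1 by (simp add: s_def)
  have v0: "v \<noteq> 0" "v \<noteq> 1" using vv u0(1) by (auto simp: v_def)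
  have uK: "u \<in> K - {0, 1}" using coordinate_field_incl[of Q 1] u0 by (simp add: Q K_def)
  have sK: "s \<in> K - {0, 1}"
    using coordinate_field_incl[of Q 3] u0 u1 by (auto simp: Q K_def s_def divide_simps)
  have vK: "v \<in> K - {0, 1}" using uK v0 by (simp add: v_def mult_closed)
  define \<xi> where "\<xi> = frag_of u + frag_of u + frag_of s + frag_of s"
  have cls: "bloch_class Q = bloch_relations K #>\<^bsub>bloch_kernel K\<^esub> \<xi>"
    by (simp add: bloch_class_def Let_def sum_4 Q \<xi>_def K_def)
  \<comment> \<open>The left factor u^4 = 1 - u^2 splits as (1 - u)(1 + u), and s cancels 1 +
    u.\<close>
  have eq1: "1 - u = u * (u * (u * (u * s)))"
  proof -
    have "u * (u * (u * (u * s))) = (1 - v) * s" unfolding vv by (simp add: v_def)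
    also have "\<dots> = (1 - u) * (s * (1 + u))" by (simp add: v_def algebra_simps)
    finally show ?thesis by (simp add: su)
  qed
  have eq3: "1 - s = s * u" using su by (simp add: algebra_simps)
  have kernel: "\<xi> \<in> carrier (bloch_kernel K)"
    unfolding \<xi>_def by (rule frag_sum_bloch_kernel) (use field_closed_axioms uK sK eq1 eq3 in auto)
  note R = bloch_relations_subgroup
  have five1: "\<xi> + frag_of (1 - v) \<in> bloch_relations K"
  proof -
    have "u * u \<noteq> 1" using v0 by (simp add: v_def)
    moreover have "(1 - u) / (1 - u * u) = s"
      using u0 u1 \<open>u * u \<noteq> 1\<close> by (simp add: s_def divide_simps) (simp add: algebra_simps)
    ultimately show ?thesis
      using bloch_five_term[OF uK uK] by (simp add: \<xi>_def v_def algebra_simps)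
  qed
  have five2: "frag_cmul 5 (frag_of v) \<in> bloch_relations K"
  proof -
    have "v * v \<noteq> 1" using vv v0(1) by auto
    moreover have "1 - v * v = v" by (simp flip: vv)
    moreover have "(1 - v) / v = v" using vv v0 by simp
    moreover have "frag_cmul 5 (frag_of v) = frag_of v + frag_of v + frag_of v + frag_of v + frag_of v"
      by (rule poly_mapping_eqI) (simp only: lookup_add lookup_frag_cmul; simp)
    ultimately show ?thesis using bloch_five_term[OF vK vK] by simp
  qed
 \<comment> \<open>Modulo relations the class is -[1 - v] by \<open>five1\<close>, hence [v], which
   \<open>five2\<close> kills after multiplication by 5.\<close>
 have "frag_cmul (int 5) (\<xi> + frag_of (1 - v)) - frag_cmul (int 5) (frag_of v + frag_of (1 - v))
      + frag_cmul 5 (frag_of v) \<in> bloch_relations K" (is "?lhs \<in> _")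
    by (rule subgroup_free_Abelian_group_add[OF R subgroup_free_Abelian_group_diff[OF R]])
       (rule subgroup_free_Abelian_group_cmul[OF R] five1 five2 bloch_one_minus[OF vK])+
  moreover have "?lhs = frag_cmul (int 5) \<xi>"
    by (simp add: frag_cmul_distrib2)
  ultimately have "frag_cmul (int 5) \<xi> \<in> bloch_relations K" by simp
  then show ?thesis
    unfolding cls K_def[symmetric]
    by (intro iffD2[OF bloch_coset_torsion_iff[OF kernel]] exI[of _ 5] conjI) simp_all
qed

lemma bloch_class_second_type:
  assumes u: "1 - u ^ 2 = - (u ^ 4)"
  defines "Q \<equiv> vector [u, - u, 1 / (1 + u), 1 / (1 - u)] :: complex^4"
  shows "bloch_class Q \<in> carrier (bloch_group (coordinate_field Q))
      - torsion_elements (bloch_group (coordinate_field Q))"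
proof -
  define K where "K = coordinate_field Q"
  interpret field_closed K unfolding K_def by (rule coordinate_field_closed)
  define s t v where "s = 1 / (1 + u)" and "t = 1 / (1 - u)" and "v = u * u"
  have Q: "Q = vector [u, - u, s, t]" by (simp add: Q_def s_def t_def)
  have u0: "u \<noteq> 0" "u \<noteq> 1" "u \<noteq> -1" using u by auto
  then have "- u \<noteq> 1" by (metis minus_minus)
  have vv: "1 - v = - (v * v)" using u by (simp add: v_def power2_eq_square power4_eq_xxxx)
  have u1: "1 + u \<noteq> 0" "1 - u \<noteq> 0" using u0 by (simp_all add: add_eq_0_iff)
  have su: "s * (1 + u) = 1" "t * (1 - u) = 1" using u1 by (simp_all add: s_def t_def)
  have v0: "v \<noteq> 0" "v \<noteq> 1" using vv u0(1) by (auto simp: v_def)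
  have K: "u \<in> K - {0, 1}" "- u \<in> K - {0, 1}" "s \<in> K - {0, 1}" "t \<in> K - {0, 1}"
    using coordinate_field_incl[of Q 1] coordinate_field_incl[of Q 2]
      coordinate_field_incl[of Q 3] coordinate_field_incl[of Q 4] u0 u1 \<open>- u \<noteq> 1\<close>
    by (auto simp: Q K_def s_def t_def divide_simps)
  define \<xi> where "\<xi> = frag_of u + frag_of (- u) + frag_of s + frag_of t"
  have cls: "bloch_class Q = bloch_relations K #>\<^bsub>bloch_kernel K\<^esub> \<xi>"
    by (simp add: bloch_class_def Let_def sum_4 Q \<xi>_def K_def)
  have eq1: "1 - u = u * (u * (u * (- u * s)))"
  proof -
    have "u * (u * (u * (- u * s))) = (1 - v) * s" unfolding vv by (simp add: v_def)
    also have "\<dots> = (1 - u) * (s * (1 + u))" by (simp add: v_def algebra_simps)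
    finally show ?thesis by (simp add: su)
  qed
  have eq2: "1 - - u = - u * (- u * (- u * (u * t)))"
  proof -
    have "- u * (- u * (- u * (u * t))) = (1 - v) * t" unfolding vv by (simp add: v_def)
    also have "\<dots> = (1 + u) * (t * (1 - u))" by (simp add: v_def algebra_simps)
    finally show ?thesis by (simp add: su)
  qed
  have eq3: "1 - s = s * u" "1 - t = t * - u" using su by (simp_all add: algebra_simps)
  have kernel: "\<xi> \<in> carrier (bloch_kernel K)"
    unfolding \<xi>_def by (rule frag_sum_bloch_kernel[OF field_closed_axioms K eq1 eq2 eq3])
  \<comment> \<open>Since s and t are the images of -u and u under z -> 1/(1 - z), which preserves
    the function, the four values add up to 2 D(u) + 2 D(s) with D = \<open>bloch_wigner\<close>, as
    needed for the relation at (u, u).\<close>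
  have "bloch_wigner s = bloch_wigner (- u)" "bloch_wigner t = bloch_wigner u"
    using u0 u1 \<open>- u \<noteq> 1\<close> bloch_wigner_inverse[of "1 + u"] bloch_wigner_inverse[of "1 - u"]
      bloch_wigner_one_minus[of "- u"] bloch_wigner_one_minus[of u]
    by (simp_all add: s_def t_def)
  moreover have "five_term u u = 0"
    by (rule five_term_relation) (use u0 v0 in \<open>auto simp: v_def\<close>)
  moreover have "(1 - u) / (1 - u * u) = s"
    using u0 u1 v0 by (simp add: s_def v_def divide_simps) (simp add: algebra_simps)
  ultimately have "bloch_wigner_hom \<xi> = - bloch_wigner (1 - v)"
    by (simp add: \<xi>_def bloch_wigner_hom_add bloch_wigner_hom_of five_term_def v_def)
  also have "\<dots> = bloch_wigner v" using v0 by (simp add: bloch_wigner_one_minus)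
  finally have "bloch_wigner_hom \<xi> \<noteq> 0"
    using bloch_wigner_nonzero[of v] vv by (simp add: power2_eq_square algebra_simps)
  then have "frag_cmul (int n) \<xi> \<notin> bloch_relations K" if "n > 0" for n
    using bloch_wigner_hom_relations[OF field_closed_axioms, of "frag_cmul (int n) \<xi>"] that
    by (auto simp: bloch_wigner_hom_cmul)
  then have "bloch_class Q \<notin> torsion_elements (bloch_group K)"
    unfolding cls bloch_coset_torsion_iff[OF kernel] by blast
  moreover have "bloch_class Q \<in> carrier (bloch_group K)"
    unfolding cls by (rule bloch_coset_carrier[OF kernel])
  ultimately show ?thesis by (simp add: K_def)
qed

section \<open>Solving the algebraic system\<close>

lemma nahm_system_4_iff:
  fixes A :: "int^4^4" and Q :: "complex^4"
  assumes A: "A = vector [vector [3, 1, 1, 0], vector [1, 3, 0, 1],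
                          vector [1, 0, 1, 0], vector [0, 1, 0, 1]]"
  shows "nahm_system A Q \<longleftrightarrow>
    1 - Q $ 1 = (Q $ 1) ^ 3 * Q $ 2 * Q $ 3 \<and> 1 - Q $ 2 = Q $ 1 * (Q $ 2) ^ 3 * Q $ 4 \<and>
    1 - Q $ 3 = Q $ 1 * Q $ 3 \<and> 1 - Q $ 4 = Q $ 2 * Q $ 4"
proof -
  have "(1::4) \<noteq> 2" "(1::4) \<noteq> 3" "(1::4) \<noteq> 4" "(2::4) \<noteq> 3" "(2::4) \<noteq> 4" "(3::4) \<noteq> 4"
    by simp_all
  then have prod_4: "prod f UNIV = f 1 * f 2 * f 3 * f 4" for f :: "4 \<Rightarrow> complex"
    unfolding UNIV_4 by (simp add: mult.assoc)
  show ?thesis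
    unfolding nahm_system_def forall_4 prod_4 A vector_4
    by (simp only: power_int_numeral power_int_1_right power_int_0_right mult_1_left mult_1_right)
qed

text \<open>The last two equations give c = 1/(1 + a) and d = 1/(1 + b). The first two then become
  a^2 (1 + a b) = 1 = b^2 (1 + a b), which forces b = a or b = -a; either sign leaves one quartic in
  a.\<close>

lemma nahm_solutions:
  fixes a b c d :: complex
  shows "a \<noteq> 0 \<and> b \<noteq> 0 \<and> c \<noteq> 0 \<and> d \<noteq> 0 \<and>
      1 - a = a ^ 3 * b * c \<and> 1 - b = a * b ^ 3 * d \<and> 1 - c = a * c \<and> 1 - d = b * d \<longleftrightarrow>
    c = 1 / (1 + a) \<and> d = 1 / (1 + b) \<and>
      (b = a \<and> 1 - a ^ 2 = a ^ 4 \<or> b = - a \<and> 1 - a ^ 2 = - (a ^ 4))"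
    (is "?L \<longleftrightarrow> ?R")
proof
  assume L: ?L
  then have c: "(1 + a) * c = 1" and d: "(1 + b) * d = 1" by (auto simp: algebra_simps)
  then have nz: "1 + a \<noteq> 0" "1 + b \<noteq> 0" by auto
  have cd: "c = 1 / (1 + a)" "d = 1 / (1 + b)"
    using c d nz by (simp_all add: field_simps)
  have "1 - a = a ^ 3 * b * c" "1 - b = a * b ^ 3 * d" using L by auto
  then have ab: "(1 - a) * (1 + a) = a ^ 3 * b * ((1 + a) * c)"
      "(1 - b) * (1 + b) = a * b ^ 3 * ((1 + b) * d)"
    by simp_all
  have 1: "1 - a ^ 2 = a ^ 3 * b"
    using ab(1)[unfolded c] by (simp add: algebra_simps power2_eq_square)
  have 2: "1 - b ^ 2 = a * b ^ 3"
    using ab(2)[unfolded d] by (simp add: algebra_simps power2_eq_square)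
  have "a ^ 2 * (1 + a * b) = 1" "b ^ 2 * (1 + a * b) = 1"
    using 1 2 by (simp_all add: algebra_simps power2_eq_square power3_eq_cube)
  then have "1 + a * b \<noteq> 0" "a ^ 2 * (1 + a * b) = b ^ 2 * (1 + a * b)" by auto
  then have "a ^ 2 = b ^ 2" by simp
  then consider "b = a" | "b = - a" by (metis power2_eq_iff minus_minus)
  then show ?R
  proof cases
    case 1
    then show ?thesis using \<open>1 - a ^ 2 = a ^ 3 * b\<close> cd by (simp add: eval_nat_numeral)
  next
    case 2
    then show ?thesis using \<open>1 - a ^ 2 = a ^ 3 * b\<close> cd by (simp add: eval_nat_numeral)
  qed
next
  assume R: ?R
  then have a: "a \<noteq> 0" "a \<noteq> 1" "a \<noteq> - 1" by auto
  then have "1 + a \<noteq> 0" "1 - a \<noteq> 0" by (simp_all add: add_eq_0_iff)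
  then have nz: "1 + a \<noteq> 0" "1 + b \<noteq> 0" using R by auto
  have ba: "b * b = a * a" using R by auto
  have "1 - a ^ 2 = a ^ 3 * b" using R by (auto simp: eval_nat_numeral)
  then have "(1 - a) * (1 + a) = a ^ 3 * b" "(1 - b) * (1 + b) = a * b ^ 3"
    using ba by (simp_all add: algebra_simps power2_eq_square power3_eq_cube)
  moreover have "1 - a = (1 - a) * (1 + a) * c" "1 - b = (1 - b) * (1 + b) * d"
    using R nz by simp_all
  ultimately have "1 - a = a ^ 3 * b * c" "1 - b = a * b ^ 3 * d" by simp_all
  moreover have "1 - c = a * c" "1 - d = b * d"
    using R nz by (simp_all add: field_simps)
  ultimately show ?L using R nz a ba by auto
qed

section \<open>Finite $q$-series identities\<close>

definition qfac :: "'a::comm_ring_1 \<Rightarrow> nat \<Rightarrow> 'a" where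
  "qfac q n = (\<Prod>k=1..n. 1 - q ^ k)"

definition qfac_plus :: "'a::comm_ring_1 \<Rightarrow> nat \<Rightarrow> 'a" where
  "qfac_plus q n = (\<Prod>k=1..n. 1 + q ^ k)"

lemma qfac_0 [simp]: "qfac q 0 = 1"
  by (simp add: qfac_def)

lemma qfac_Suc: "qfac q (Suc n) = qfac q n * (1 - q ^ Suc n)"
  by (simp add: qfac_def)

lemma qfac_plus_0 [simp]: "qfac_plus q 0 = 1"
  by (simp add: qfac_plus_def)

lemma qfac_plus_Suc: "qfac_plus q (Suc n) = qfac_plus q n * (1 + q ^ Suc n)"
  by (simp add: qfac_plus_def)

lemma qfac_square: "qfac (q\<^sup>2) n = qfac q n * qfac_plus q n"
proof (induction n)
  case (Suc n)
  have "1 - a * a = (1 - a) * (1 + a)" for a :: 'a by (simp add: algebra_simps)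
  then have "1 - (q\<^sup>2) ^ Suc n = (1 - q ^ Suc n) * (1 + q ^ Suc n)"
    by (simp only: power2_eq_square power_mult_distrib)
  with Suc show ?case by (simp only: qfac_Suc qfac_plus_Suc) (simp only: mult_ac)
qed simp

text \<open>The q-Pascal rule involves no division, so it makes sense for every q in a commutative
  ring; the quotient form follows where the q-factorials do not vanish.\<close>

fun gauss_binomial :: "'a::comm_ring_1 \<Rightarrow> nat \<Rightarrow> nat \<Rightarrow> 'a" where
  "gauss_binomial q n 0 = 1"
| "gauss_binomial q 0 (Suc k) = 0"
| "gauss_binomial q (Suc n) (Suc k) =
     gauss_binomial q n (Suc k) + q ^ (n - k) * gauss_binomial q n k"

lemma gauss_binomial_eq_0: "n < k \<Longrightarrow> gauss_binomial q n k = 0"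
  by (induction q n k rule: gauss_binomial.induct) auto

lemma gauss_binomial_qfac:
  "k \<le> n \<Longrightarrow> gauss_binomial q n k * qfac q k * qfac q (n - k) = qfac q n"
proof (induction q n k rule: gauss_binomial.induct)
  case (3 q n k)
  then have "k \<le> n" by simp
  have 1: "gauss_binomial q n (Suc k) * qfac q (Suc k) * qfac q (n - k) = qfac q n * (1 - q ^ (n - k))"
  proof (cases "k = n")
    case True
    then show ?thesis by (simp add: gauss_binomial_eq_0)
  next
    case False
    with \<open>k \<le> n\<close> have "n - k = Suc (n - Suc k)" "Suc k \<le> n" by auto
    then have "qfac q (n - k) = qfac q (n - Suc k) * (1 - q ^ (n - k))"
      by (metis qfac_Suc)
    then show ?thesis
      using 3(1)[OF \<open>Suc k \<le> n\<close>] by (simp only: mult.assoc[symmetric])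
  qed
  have 2: "q ^ (n - k) * gauss_binomial q n k * qfac q (Suc k) * qfac q (n - k)
      = qfac q n * (q ^ (n - k) * (1 - q ^ Suc k))"
    unfolding 3(2)[OF \<open>k \<le> n\<close>, symmetric] qfac_Suc by (simp only: mult_ac)
  have "q ^ (n - k) * q ^ Suc k = q ^ Suc n"
    using \<open>k \<le> n\<close> by (simp only: power_add[symmetric]) simp
  then have "qfac q n * (1 - q ^ (n - k)) + qfac q n * (q ^ (n - k) * (1 - q ^ Suc k)) = qfac q (Suc n)"
    by (simp only: qfac_Suc right_diff_distrib mult_1_right) (simp add: algebra_simps)
  then show ?case
    by (simp only: gauss_binomial.simps distrib_right 1 2 diff_Suc_Suc)
qed simp_all

lemma gauss_binomial_theorem:
  "(\<Prod>i<n. 1 + x * q ^ i) = (\<Sum>k\<le>n. gauss_binomial q n k * q ^ (k * (k - 1) div 2) * x ^ k)"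
proof (induction n)
  case (Suc n)
  define g where "g k = gauss_binomial q n k * q ^ (k * (k - 1) div 2) * x ^ k" for k
  have tri: "Suc k * (Suc k - 1) div 2 = k * (k - 1) div 2 + k" for k
    by (cases k) (auto simp: algebra_simps)
  have step: "gauss_binomial q (Suc n) (Suc k) * q ^ (Suc k * (Suc k - 1) div 2) * x ^ Suc k
      = g (Suc k) + x * q ^ n * g k" if "k \<le> n" for k
  proof -
    have e: "q ^ n = q ^ (n - k) * q ^ k" using that by (simp flip: power_add)
    show ?thesis
      unfolding g_def gauss_binomial.simps tri e power_add power_Suc
      by (simp only: ring_distribs mult_ac)
  qed
  have "(\<Sum>k\<le>Suc n. gauss_binomial q (Suc n) k * q ^ (k * (k - 1) div 2) * x ^ k)
      = 1 + (\<Sum>k\<le>n. g (Suc k) + x * q ^ n * g k)"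
    unfolding sum.atMost_Suc_shift
    by (intro arg_cong2[of _ _ _ _ "(+)"] sum.cong refl step) simp_all
  also have "\<dots> = (1 + (\<Sum>k\<le>n. g (Suc k))) + x * q ^ n * (\<Sum>k\<le>n. g k)"
    by (simp add: sum.distrib sum_distrib_left)
  also have "1 + (\<Sum>k\<le>n. g (Suc k)) = (\<Sum>k\<le>Suc n. g k)"
    unfolding sum.atMost_Suc_shift by (simp add: g_def)
  also have "\<dots> = (\<Sum>k\<le>n. g k)"
    by (simp add: g_def gauss_binomial_eq_0)
  finally show ?case
    using Suc by (simp add: g_def algebra_simps)
qed simp

section \<open>The Bailey chain\<close>

locale qfac_nonzero =
  fixes q :: "'a::field"
  assumes qfac_nonzero: "\<And>n. qfac q n \<noteq> 0"
begin

lemma gauss_binomial_eq: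
  assumes "k \<le> n"
  shows "gauss_binomial q n k = qfac q n / (qfac q k * qfac q (n - k))"
  using gauss_binomial_qfac[OF assms, of q] qfac_nonzero[of k] qfac_nonzero[of "n - k"]
  by (simp add: eq_divide_eq mult.assoc)

lemma gauss_binomial_symmetric:
  assumes "k \<le> n"
  shows "gauss_binomial q n (n - k) = gauss_binomial q n k"
  using assms by (simp add: gauss_binomial_eq mult.commute)

text \<open>The q-Vandermonde sum for [M + L, M + c] in the limit of infinite L. The Pascal rule in
  M turns c into c + 1 in its second part, so the induction keeps c arbitrary.\<close>

lemma q_vandermonde_limit:
  "(\<Sum>k\<le>M. gauss_binomial q M k * q ^ (k * (k + c)) / qfac q (k + c)) = 1 / qfac q (M + c)"
proof (induction M arbitrary: c)
  case (Suc M)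
  define g where "g c k = gauss_binomial q M k * q ^ (k * (k + c)) / qfac q (k + c)" for c k
  have step: "gauss_binomial q (Suc M) (Suc k) * q ^ (Suc k * (Suc k + c)) / qfac q (Suc k + c)
      = g c (Suc k) + q ^ Suc (M + c) * g (Suc c) k" if "k \<le> M" for k
  proof -
    have "(M - k) + Suc k * (Suc k + c) = Suc (M + c) + k * (k + Suc c)"
      using that by (simp add: algebra_simps)
    then have e: "q ^ (M - k) * q ^ (Suc k * (Suc k + c)) = q ^ Suc (M + c) * q ^ (k * (k + Suc c))"
      by (simp only: flip: power_add)
    have "q ^ (M - k) * gauss_binomial q M k * q ^ (Suc k * (Suc k + c))
        = q ^ Suc (M + c) * (gauss_binomial q M k * q ^ (k * (k + Suc c)))"
      using arg_cong[OF e, of "\<lambda>x. x * gauss_binomial q M k"] by (simp only: mult_ac)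
    then show ?thesis
      unfolding g_def gauss_binomial.simps by (simp only: distrib_right add_divide_distrib) simp
  qed
  have "(\<Sum>k\<le>Suc M. gauss_binomial q (Suc M) k * q ^ (k * (k + c)) / qfac q (k + c))
      = g c 0 + (\<Sum>k\<le>M. g c (Suc k) + q ^ Suc (M + c) * g (Suc c) k)"
    unfolding sum.atMost_Suc_shift
    by (intro arg_cong2[of _ _ _ _ "(+)"] sum.cong refl step) (simp_all add: g_def)
  also have "\<dots> = (g c 0 + (\<Sum>k\<le>M. g c (Suc k))) + q ^ Suc (M + c) * (\<Sum>k\<le>M. g (Suc c) k)"
    by (simp add: sum.distrib sum_distrib_left)
  also have "g c 0 + (\<Sum>k\<le>M. g c (Suc k)) = (\<Sum>k\<le>Suc M. g c k)"
    unfolding sum.atMost_Suc_shift ..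
  also have "\<dots> = (\<Sum>k\<le>M. g c k)"
    by (simp add: g_def gauss_binomial_eq_0)
  also have "\<dots> = 1 / qfac q (M + c)" unfolding g_def by (rule Suc.IH)
  also have "(\<Sum>k\<le>M. g (Suc c) k) = 1 / qfac q (Suc (M + c))"
    unfolding g_def by (subst Suc.IH) simp
  also have "1 / qfac q (M + c) + q ^ Suc (M + c) * (1 / qfac q (Suc (M + c))) = 1 / qfac q (Suc M + c)"
  proof -
    have "1 - q ^ Suc (M + c) \<noteq> 0" "qfac q (M + c) \<noteq> 0"
      using qfac_nonzero[of "Suc (M + c)"] unfolding qfac_Suc by auto
    then show ?thesis unfolding add_Suc qfac_Suc by (simp add: field_simps)
  qed
  finally show ?case .
qed simp

text \<open>Bressoud's identity, the step of the Bailey chain.\<close>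

lemma bailey_kernel:
  assumes "j \<le> N"
  shows "1 / (qfac q (N - j) * qfac q (N + j)) =
    (\<Sum>s=j..N. q ^ (s\<^sup>2 - j\<^sup>2) / (qfac q (N - s) * (qfac q (s - j) * qfac q (s + j))))"
proof -
  have "(\<Sum>s=j..N. q ^ (s\<^sup>2 - j\<^sup>2) / (qfac q (N - s) * (qfac q (s - j) * qfac q (s + j))))
      = (\<Sum>k\<le>N - j. q ^ ((k + j)\<^sup>2 - j\<^sup>2)
           / (qfac q (N - (k + j)) * (qfac q (k + j - j) * qfac q (k + j + j))))"
    by (rule sum.reindex_bij_witness[of _ "\<lambda>k. k + j" "\<lambda>s. s - j"]) (use assms in auto)
  \<comment> \<open>After the shift s = k + j this is \<open>q_vandermonde_limit\<close> with M = N
    - j and c = 2 j, divided by (q)_{N-j}.\<close>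
  also have "\<dots> = (\<Sum>k\<le>N - j. (gauss_binomial q (N - j) k * q ^ (k * (k + 2 * j)) / qfac q (k + 2 * j))
      / qfac q (N - j))"
  proof (rule sum.cong)
    fix k assume k: "k \<in> {..N - j}"
    have 1: "(k + j)\<^sup>2 - j\<^sup>2 = k * (k + 2 * j)"
      by (simp add: power2_eq_square algebra_simps)
    have 2: "N - (k + j) = N - j - k" "k + j + j = k + 2 * j" "k + j - j = k" by auto
    show "q ^ ((k + j)\<^sup>2 - j\<^sup>2)
           / (qfac q (N - (k + j)) * (qfac q (k + j - j) * qfac q (k + j + j)))
        = (gauss_binomial q (N - j) k * q ^ (k * (k + 2 * j)) / qfac q (k + 2 * j)) / qfac q (N - j)"
      unfolding 1 2 using gauss_binomial_eq[of k "N - j"] k qfac_nonzero[of "N - j"]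
      by (simp add: mult_ac)
  qed simp
  also have "\<dots> = 1 / qfac q (N - j + 2 * j) / qfac q (N - j)"
    unfolding sum_divide_distrib[symmetric] q_vandermonde_limit ..
  also have "N - j + 2 * j = N + j" using assms by simp
  finally show ?thesis by (simp add: mult.commute)
qed

text \<open>The sequence beta_N of the Bailey pair relative to 1 with alpha_j = w_j.\<close>

definition bailey_sum :: "(nat \<Rightarrow> 'a) \<Rightarrow> nat \<Rightarrow> 'a" where
  "bailey_sum w N = (\<Sum>j\<le>N. w j / (qfac q (N - j) * qfac q (N + j)))"

text \<open>Bailey's lemma with both free parameters sent to infinity: insert
  \<open>bailey_kernel\<close> in each term and exchange the two sums over j \<le> s \<le>
  N.\<close>

lemma bailey_sum_step:
  "bailey_sum (\<lambda>j. q ^ j\<^sup>2 * w j) N = (\<Sum>s\<le>N. q ^ s\<^sup>2 / qfac q (N - s) * bailey_sum w s)"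
proof -
  define f where "f j s = q ^ s\<^sup>2 / qfac q (N - s) * (w j / (qfac q (s - j) * qfac q (s + j)))" for j s
  have "q ^ j\<^sup>2 * w j / (qfac q (N - j) * qfac q (N + j)) = (\<Sum>s=j..N. f j s)" if "j \<le> N" for j
  proof -
    have "q ^ j\<^sup>2 * w j / (qfac q (N - j) * qfac q (N + j))
        = q ^ j\<^sup>2 * w j * (1 / (qfac q (N - j) * qfac q (N + j)))"
      by simp
    also have "\<dots> = (\<Sum>s=j..N. f j s)"
      unfolding bailey_kernel[OF that] sum_distrib_left
    proof (rule sum.cong)
      fix s assume "s \<in> {j..N}"
      then have "q ^ s\<^sup>2 = q ^ j\<^sup>2 * q ^ (s\<^sup>2 - j\<^sup>2)"
        by (simp flip: power_add)
      then show "q ^ j\<^sup>2 * w j * (q ^ (s\<^sup>2 - j\<^sup>2) / (qfac q (N - s) * (qfac q (s - j) * qfac q (s + j)))) = f j s"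
        by (simp add: f_def)
    qed simp
    finally show ?thesis .
  qed
  then have "bailey_sum (\<lambda>j. q ^ j\<^sup>2 * w j) N = (\<Sum>j\<le>N. \<Sum>s=j..N. f j s)"
    unfolding bailey_sum_def by (intro sum.cong) auto
  also have "\<dots> = (\<Sum>s\<le>N. \<Sum>j\<le>s. f j s)"
    unfolding sum.Sigma[OF finite_atMost ballI[OF finite_atLeastAtMost]]
      sum.Sigma[OF finite_atMost ballI[OF finite_atMost]]
    by (rule sum.reindex_bij_witness[of _ "\<lambda>(s, j). (j, s)" "\<lambda>(j, s). (s, j)"]) auto
  also have "\<dots> = (\<Sum>s\<le>N. q ^ s\<^sup>2 / qfac q (N - s) * bailey_sum w s)"
    by (simp add: f_def bailey_sum_def sum_distrib_left)
  finally show ?thesis .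
qed

text \<open>The terms of \<open>\<Sum> (-1)\<^sup>j q\<^bsup>j(j+1)/2\<^esup>\<close> for \<open>j\<close> and \<open>-j\<close>, taken together.\<close>

definition theta_weight :: "nat \<Rightarrow> 'a" where
  "theta_weight j = (if j = 0 then 1 else (-1) ^ j * (q ^ (j * (j + 1) div 2) + q ^ (j * (j - 1) div 2)))"

text \<open>The unit Bailey pair, from which the chain starts.\<close>

lemma bailey_sum_theta_weight: "bailey_sum theta_weight N = (if N = 0 then 1 else 0)"
proof (cases N)
  case 0
  then show ?thesis by (simp add: bailey_sum_def theta_weight_def)
next
  case (Suc M)
  define t where "t j = theta_weight j / (qfac q (N - j) * qfac q (N + j))" for j
  \<comment> \<open>\<open>(1 - q\<^sup>N) t\<close> telescopes: it is the difference sequence of \<open>u\<close>.\<close>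
  define u where "u j = (-1) ^ j * q ^ (j * (j + 1) div 2) / (qfac q (M - j) * qfac q (N + j))" for j
  have step: "(1 - q ^ N) * t (Suc j) = (if Suc j \<le> M then u (Suc j) else 0) - u j" if "j \<le> M" for j
  proof -
    have tri: "Suc j * (Suc j - 1) div 2 = j * (j + 1) div 2"
      "Suc j * (Suc j + 1) div 2 = j * (j + 1) div 2 + Suc j"
      by auto
    define A where "A = (-1) ^ j * q ^ (j * (j + 1) div 2)"
    have NM: "N - Suc j = M - j" "N + Suc j = Suc (N + j)" using Suc by auto
    have nz: "qfac q (M - j) \<noteq> 0" "qfac q (N + j) \<noteq> 0" "1 - q ^ Suc (N + j) \<noteq> 0"
      using qfac_nonzero qfac_nonzero[of "Suc (N + j)"] unfolding qfac_Suc by auto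
    have t: "t (Suc j) = - A * (q ^ Suc j + 1) / (qfac q (M - j) * (qfac q (N + j) * (1 - q ^ Suc (N + j))))"
      unfolding t_def theta_weight_def NM tri A_def qfac_Suc power_add by (simp add: algebra_simps)
    have uj: "u j = A * (1 - q ^ Suc (N + j)) / (qfac q (M - j) * (qfac q (N + j) * (1 - q ^ Suc (N + j))))"
      using nz by (simp add: u_def A_def)
    \<comment> \<open>At j = M the next term of \<open>u\<close> is absent, and the factor 1 - q^0
      makes the common formula vanish as well.\<close>
    have u': "(if Suc j \<le> M then u (Suc j) else 0)
        = - A * q ^ Suc j * (1 - q ^ (M - j)) / (qfac q (M - j) * (qfac q (N + j) * (1 - q ^ Suc (N + j))))"
    proof (cases "Suc j \<le> M")
      case True
      then have "M - j = Suc (M - Suc j)" by auto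
      then have e: "qfac q (M - j) = qfac q (M - Suc j) * (1 - q ^ (M - j))" by (metis qfac_Suc)
      then have "1 - q ^ (M - j) \<noteq> 0" using nz by auto
      then show ?thesis
        using True unfolding e u_def NM(2) tri power_add qfac_Suc by (simp add: A_def)
    next
      case False
      then have "M - j = 0" using that by simp
      then show ?thesis using False by simp
    qed
    have "q ^ Suc j * q ^ (M - j) = q ^ N" "q ^ Suc (N + j) = q ^ N * q ^ Suc j"
      using Suc that by (simp_all flip: power_add power_Suc)
    then have "(1 - q ^ N) * (- A * (q ^ Suc j + 1))
        = - A * q ^ Suc j * (1 - q ^ (M - j)) - A * (1 - q ^ Suc (N + j))"
      by (simp only:) (simp only: right_diff_distrib mult.assoc \<open>q ^ Suc j * q ^ (M - j) = q ^ N\<close>,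
          simp add: algebra_simps)
    then show ?thesis unfolding t uj u' by (simp only: times_divide_eq_right flip: diff_divide_distrib)
  qed
  have t0: "(1 - q ^ N) * t 0 = u 0"
  proof -
    have "1 - q ^ N \<noteq> 0" "qfac q N = qfac q M * (1 - q ^ N)"
      using qfac_nonzero[of N] unfolding Suc qfac_Suc by auto
    then show ?thesis using qfac_nonzero by (simp add: t_def u_def theta_weight_def)
  qed
  have "(1 - q ^ N) * (\<Sum>j\<le>n. t j) = (if n \<le> M then u n else 0)" if "n \<le> N" for n
    using that
  proof (induction n)
    case 0
    then show ?case using t0 by simp
  next
    case (Suc n)
    then show ?case using step[of n] \<open>N = Suc M\<close> by (simp add: distrib_left)
  qed
  from this[of N] have "(1 - q ^ N) * (\<Sum>j\<le>N. t j) = 0" using Suc by simp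
  moreover have "1 - q ^ N \<noteq> 0" using qfac_nonzero[of N] unfolding Suc qfac_Suc by auto
  ultimately show ?thesis using Suc by (simp add: bailey_sum_def t_def)
qed

lemma finite_rogers_ramanujan:
  "(\<Sum>s\<le>N. q ^ s\<^sup>2 / (qfac q (N - s) * qfac q s))
   = (\<Sum>j\<le>N. q ^ (2 * j\<^sup>2) * theta_weight j / (qfac q (N - j) * qfac q (N + j)))"
proof -
  \<comment> \<open>First step of the chain: of the unit pair only the term with index 0
    survives.\<close>
  have 3: "bailey_sum (\<lambda>j. q ^ j\<^sup>2 * theta_weight j) s = 1 / qfac q s" for s
  proof -
    have "bailey_sum (\<lambda>j. q ^ j\<^sup>2 * theta_weight j) s
        = (\<Sum>k\<le>s. if k = 0 then q ^ k\<^sup>2 / qfac q (s - k) else 0)"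
      unfolding bailey_sum_step bailey_sum_theta_weight by (intro sum.cong) auto
    then show ?thesis by (simp add: sum.delta)
  qed
  have "(\<Sum>j\<le>N. q ^ (2 * j\<^sup>2) * theta_weight j / (qfac q (N - j) * qfac q (N + j)))
      = bailey_sum (\<lambda>j. q ^ j\<^sup>2 * (q ^ j\<^sup>2 * theta_weight j)) N"
    unfolding bailey_sum_def by (simp add: mult_2 power_add mult.assoc)
  also have "\<dots> = (\<Sum>s\<le>N. q ^ s\<^sup>2 / (qfac q (N - s) * qfac q s))"
    unfolding bailey_sum_step[of "\<lambda>j. q ^ j\<^sup>2 * theta_weight j"] 3 by simp
  finally show ?thesis by simp
qed

end

section \<open>A sum of Gaussian binomials in base q^2\<close>

definition tri_num :: "int \<Rightarrow> nat" where
  "tri_num d = nat (d * (d + 1) div 2)"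

text \<open>Exponents are compared after doubling, which removes both the integer division and the
  conversion to a natural number, for negative d too.\<close>

lemma two_tri_num: "2 * int (tri_num d) = d * (d + 1)"
proof -
  have "d * (d + 1) \<ge> 0" by (cases "d \<ge> 0") (auto simp: mult_nonpos_nonpos)
  moreover have "even (d * (d + 1))" by auto
  ultimately show ?thesis by (simp add: tri_num_def)
qed

text \<open>Write T for \<open>tri_num\<close> and d = 2m - N. The Pascal rule in base q^2 splits
  the sum for N + 1 into q^{N+1} times the old sum and the old sum with T(d - 1) in place of T(d).
  As T(d - 1) = T(-d), the reflection m -> N - m identifies the latter with the old sum, so each
  step multiplies by 1 + q^{N+1}.\<close>

lemma gauss_binomial_tri_num_sum:
  assumes "\<And>n. qfac (q\<^sup>2 :: 'a::field) n \<noteq> 0"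
  shows "(\<Sum>m\<le>N. gauss_binomial (q\<^sup>2) N m * q ^ tri_num (2 * int m - int N)) = qfac_plus q N"
proof (induction N)
  case 0
  show ?case by (simp add: tri_num_def)
next
  case (Suc N)
  interpret qfac_nonzero "q\<^sup>2" by standard (rule assms)
  let ?g = "gauss_binomial (q\<^sup>2) N"
  define d where "d m = 2 * int m - int N" for m
  define F where "F = (\<Sum>m\<le>N. ?g m * q ^ tri_num (d m))"
  have step: "gauss_binomial (q\<^sup>2) (Suc N) (Suc m) * q ^ tri_num (2 * int (Suc m) - int (Suc N))
      = ?g (Suc m) * q ^ tri_num (d (Suc m) - 1) + q ^ Suc N * (?g m * q ^ tri_num (d m))"
    if "m \<le> N" for m
  proof -
    have d: "2 * int (Suc m) - int (Suc N) = d (Suc m) - 1" by (simp add: d_def)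
    have "2 * int (2 * (N - m) + tri_num (d (Suc m) - 1)) = 2 * int (Suc N + tri_num (d m))"
      using that unfolding of_nat_add distrib_left two_tri_num
      by (simp add: d_def of_nat_diff algebra_simps)
    then have "2 * (N - m) + tri_num (d (Suc m) - 1) = Suc N + tri_num (d m)"
      by (simp only: mult_cancel_left of_nat_eq_iff) simp
    then have e: "(q\<^sup>2) ^ (N - m) * q ^ tri_num (d (Suc m) - 1) = q ^ Suc N * q ^ tri_num (d m)"
      by (simp only: flip: power_add power_mult)
    have "(q\<^sup>2) ^ (N - m) * ?g m * q ^ tri_num (d (Suc m) - 1) = q ^ Suc N * (?g m * q ^ tri_num (d m))"
      using arg_cong[OF e, of "\<lambda>x. x * ?g m"] by (simp only: mult_ac)
    then show ?thesis unfolding d gauss_binomial.simps by (simp only: distrib_right)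
  qed
  have d0: "2 * int 0 - int (Suc N) = d 0 - 1" by (simp add: d_def)
  have "(\<Sum>m\<le>Suc N. gauss_binomial (q\<^sup>2) (Suc N) m * q ^ tri_num (2 * int m - int (Suc N)))
      = ?g 0 * q ^ tri_num (d 0 - 1)
        + (\<Sum>m\<le>N. ?g (Suc m) * q ^ tri_num (d (Suc m) - 1) + q ^ Suc N * (?g m * q ^ tri_num (d m)))"
    unfolding sum.atMost_Suc_shift
    by (intro arg_cong2[of _ _ _ _ "(+)"] sum.cong refl step) (simp_all only: d0 atMost_iff gauss_binomial.simps(1))
  also have "\<dots> = (?g 0 * q ^ tri_num (d 0 - 1) + (\<Sum>m\<le>N. ?g (Suc m) * q ^ tri_num (d (Suc m) - 1)))
      + q ^ Suc N * F"
    by (simp add: sum.distrib sum_distrib_left F_def)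
  also have "?g 0 * q ^ tri_num (d 0 - 1) + (\<Sum>m\<le>N. ?g (Suc m) * q ^ tri_num (d (Suc m) - 1))
      = (\<Sum>m\<le>Suc N. ?g m * q ^ tri_num (d m - 1))"
    unfolding sum.atMost_Suc_shift ..
  also have "\<dots> = (\<Sum>m\<le>N. ?g m * q ^ tri_num (d m - 1))"
    by (simp add: gauss_binomial_eq_0)
  also have "\<dots> = F"
    unfolding F_def
  proof (rule sum.reindex_bij_witness[of _ "\<lambda>m. N - m" "\<lambda>m. N - m"])
    fix m assume m: "m \<in> {..N}"
    have "tri_num (d (N - m)) = tri_num (d m - 1)"
      using m by (simp add: tri_num_def d_def of_nat_diff algebra_simps)
    then show "?g (N - m) * q ^ tri_num (d (N - m)) = ?g m * q ^ tri_num (d m - 1)"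
      using m by (simp add: gauss_binomial_symmetric)
  qed auto
  also have "F + q ^ Suc N * F = qfac_plus q (Suc N)"
    using Suc by (simp add: F_def d_def qfac_plus_Suc algebra_simps)
  finally show ?case .
qed

section \<open>Passage to the limit\<close>

text \<open>Tannery's theorem when the range of summation grows with the parameter: terms beyond the
  range are replaced by 0, which a nonnegative majorant also dominates.\<close>

lemma tannery_partial_sums:
  fixes a :: "nat \<Rightarrow> nat \<Rightarrow> 'a::{real_normed_algebra, banach}"
  assumes lim: "\<And>k. (\<lambda>n. a k n) \<longlonglongrightarrow> b k"
    and bound: "\<And>k n. k \<le> n \<Longrightarrow> norm (a k n) \<le> M k"
    and M: "summable M" "\<And>k. 0 \<le> M k"
  shows "summable (\<lambda>k. norm (b k))" and "(\<lambda>n. \<Sum>k\<le>n. a k n) \<longlonglongrightarrow> suminf b"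
proof -
  define a' where "a' k n = (if k \<le> n then a k n else 0)" for k n
  have "(\<lambda>n. a' k n) \<longlonglongrightarrow> b k" for k
    by (rule Lim_transform_eventually[OF lim])
       (use eventually_ge_at_top[of k] in eventually_elim, simp add: a'_def)
  moreover have "\<forall>\<^sub>F (k, n) in at_top \<times>\<^sub>F sequentially. norm (a' k n) \<le> M k"
    by (intro always_eventually) (auto simp: a'_def bound M)
  ultimately have *: "summable (\<lambda>k. norm (b k)) \<and> (\<lambda>n. suminf (\<lambda>k. a' k n)) \<longlonglongrightarrow> suminf b"
    using tannerys_theorem[of a' b sequentially M] M by simp
  have "suminf (\<lambda>k. a' k n) = (\<Sum>k\<le>n. a k n)" for n
  proof -
    have "suminf (\<lambda>k. a' k n) = (\<Sum>k\<le>n. a' k n)"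
      by (rule suminf_finite) (auto simp: a'_def)
    then show ?thesis by (simp add: a'_def)
  qed
  then show "summable (\<lambda>k. norm (b k))" "(\<lambda>n. \<Sum>k\<le>n. a k n) \<longlonglongrightarrow> suminf b"
    using * by simp_all
qed

lemma norm_power_add_le:
  fixes q :: complex
  assumes "norm q < 1" "k \<le> e"
  shows "norm (q ^ e) \<le> norm q ^ k"
  using assms by (simp add: norm_power power_decreasing)

locale nome =
  fixes q :: complex
  assumes norm_q: "norm q < 1"
begin

lemma norm_q_power: "norm (q ^ Suc n) < 1"
proof -
  have "norm (q ^ Suc n) \<le> norm q ^ 1"
    by (rule norm_power_add_le) (use norm_q in auto)
  then show ?thesis using norm_q by simp
qed

sublocale qfac_nonzero q
proof
  show "qfac q n \<noteq> 0" for n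
  proof (induction n)
    case (Suc n)
    have "1 - q ^ Suc n \<noteq> 0" using norm_q_power[of n] by auto
    with Suc show ?case unfolding qfac_Suc by simp
  qed simp
qed

lemma nome_square: "nome (q\<^sup>2)"
  using norm_q_power[of 1] by unfold_locales (simp add: numeral_2_eq_2)

definition qfac_inf :: complex where
  "qfac_inf = prodinf (\<lambda>n. 1 - q ^ Suc n)"

definition qfac_plus_inf :: complex where
  "qfac_plus_inf = prodinf (\<lambda>n. 1 + q ^ Suc n)"

lemma summable_norm_q_power: "summable (\<lambda>n. norm (q ^ Suc n))"
  using summable_geometric[of "norm q"] norm_q summable_Suc_iff[of "\<lambda>n. norm q ^ n"]
  by (simp add: norm_power norm_mult)

lemma convergent_prod_minus: "convergent_prod (\<lambda>n. 1 - q ^ Suc n)"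
proof (rule abs_convergent_prod_imp_convergent_prod[OF summable_imp_abs_convergent_prod])
  have "1 - x - 1 = - x" for x :: complex by simp
  then have "norm (1 - q ^ Suc n - 1) = norm (q ^ Suc n)" for n
    by (simp only: norm_minus_cancel)
  then show "summable (\<lambda>n. norm (1 - q ^ Suc n - 1))"
    using summable_norm_q_power by simp
qed

lemma convergent_prod_plus: "convergent_prod (\<lambda>n. 1 + q ^ Suc n)"
  by (rule abs_convergent_prod_imp_convergent_prod[OF summable_imp_abs_convergent_prod])
     (use summable_norm_q_power in \<open>simp only: add_diff_cancel_left'\<close>)

lemma qfac_inf_nonzero: "qfac_inf \<noteq> 0"
  unfolding qfac_inf_def
proof (rule prodinf_nonzero[OF convergent_prod_minus])
  show "1 - q ^ Suc n \<noteq> 0" for n using norm_q_power[of n] by auto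
qed

lemma qfac_tendsto: "qfac q \<longlonglongrightarrow> qfac_inf"
proof -
  have "(\<lambda>n. \<Prod>i\<le>n. 1 - q ^ Suc i) \<longlonglongrightarrow> qfac_inf"
    unfolding qfac_inf_def by (rule convergent_prod_LIMSEQ[OF convergent_prod_minus])
  moreover have "(\<Prod>i\<le>n. 1 - q ^ Suc i) = qfac q (Suc n)" for n
    unfolding qfac_def by (rule prod.reindex_bij_witness[of _ "\<lambda>k. k - 1" Suc]) auto
  ultimately have "(\<lambda>n. qfac q (Suc n)) \<longlonglongrightarrow> qfac_inf" by simp
  then show ?thesis by (rule LIMSEQ_imp_Suc)
qed

lemma qfac_plus_tendsto: "qfac_plus q \<longlonglongrightarrow> qfac_plus_inf"
proof -
  have "(\<lambda>n. \<Prod>i\<le>n. 1 + q ^ Suc i) \<longlonglongrightarrow> qfac_plus_inf"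
    unfolding qfac_plus_inf_def by (rule convergent_prod_LIMSEQ[OF convergent_prod_plus])
  moreover have "(\<Prod>i\<le>n. 1 + q ^ Suc i) = qfac_plus q (Suc n)" for n
    unfolding qfac_plus_def by (rule prod.reindex_bij_witness[of _ "\<lambda>k. k - 1" Suc]) auto
  ultimately have "(\<lambda>n. qfac_plus q (Suc n)) \<longlonglongrightarrow> qfac_plus_inf" by simp
  then show ?thesis by (rule LIMSEQ_imp_Suc)
qed

lemma inverse_qfac_tendsto: "(\<lambda>n. 1 / qfac q n) \<longlonglongrightarrow> 1 / qfac_inf"
  by (intro tendsto_divide tendsto_const qfac_tendsto qfac_inf_nonzero)

lemma inverse_qfac_shift_tendsto:
  "(\<lambda>n. 1 / qfac q (n - k)) \<longlonglongrightarrow> 1 / qfac_inf"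
  "(\<lambda>n. 1 / qfac q (n + k)) \<longlonglongrightarrow> 1 / qfac_inf"
  by (rule filterlim_compose[OF inverse_qfac_tendsto filterlim_minus_const_nat_at_top])
     (rule LIMSEQ_ignore_initial_segment[OF inverse_qfac_tendsto])

text \<open>Such a bound, times powers of |q|, supplies the geometric majorants used below.\<close>

lemma inverse_qfac_bound:
  obtains C where "C > 0" "\<And>n. norm (1 / qfac q n) \<le> C"
proof -
  have "Bseq (\<lambda>n. 1 / qfac q n)"
    using inverse_qfac_tendsto by (intro convergent_imp_Bseq convergentI)
  then show thesis using that by (auto elim: BseqE)
qed

lemma qfac_bound:
  obtains C where "C > 0" "\<And>n. norm (qfac q n) \<le> C"
proof -
  have "Bseq (qfac q)"
    using qfac_tendsto by (intro convergent_imp_Bseq convergentI)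
  then show thesis using that by (auto elim: BseqE)
qed

text \<open>Let N tend to infinity in the finite identity. The left side acquires one factor
  1/(q)_\<infinity> and the right side two, which leaves a single division.\<close>

lemma rogers_ramanujan_sum:
  "summable (\<lambda>s. norm (q ^ s\<^sup>2 / qfac q s))"
  "summable (\<lambda>j. norm (q ^ (2 * j\<^sup>2) * theta_weight j))"
  "(suminf (\<lambda>s. q ^ s\<^sup>2 / qfac q s)) = (suminf (\<lambda>j. q ^ (2 * j\<^sup>2) * theta_weight j)) / qfac_inf"
proof -
  obtain C where C: "C > 0" "\<And>n. norm (1 / qfac q n) \<le> C" by (rule inverse_qfac_bound, rule that)
  have CC: "norm (1 / qfac q m * (1 / qfac q n)) \<le> C * C" for m n
    unfolding norm_mult using C by (intro mult_mono) auto
  have geo: "summable (\<lambda>k. c * norm q ^ k)" for c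
    using norm_q by (intro summable_mult summable_geometric) simp
  define a where "a s n = q ^ s\<^sup>2 * (1 / qfac q (n - s) * (1 / qfac q s))" for s n
  have a_lim: "(\<lambda>n. a s n) \<longlonglongrightarrow> q ^ s\<^sup>2 * (1 / qfac_inf * (1 / qfac q s))" for s
    unfolding a_def by (intro tendsto_mult tendsto_const inverse_qfac_shift_tendsto)
  have a_bound: "norm (a s n) \<le> C * C * norm q ^ s" for s n
  proof -
    have "s \<le> s\<^sup>2" by (simp add: power2_eq_square)
    then have "norm (q ^ s\<^sup>2) * norm (1 / qfac q (n - s) * (1 / qfac q s)) \<le> norm q ^ s * (C * C)"
      using norm_q by (intro mult_mono CC norm_power_add_le) auto
    then show ?thesis by (simp only: a_def norm_mult mult_ac)
  qed
  note A = tannery_partial_sums[OF a_lim a_bound geo]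
  define b where "b j n = q ^ (2 * j\<^sup>2) * theta_weight j * (1 / qfac q (n - j) * (1 / qfac q (n + j)))" for j n
  have b_lim: "(\<lambda>n. b j n) \<longlonglongrightarrow> q ^ (2 * j\<^sup>2) * theta_weight j * (1 / qfac_inf * (1 / qfac_inf))" for j
    unfolding b_def by (intro tendsto_mult tendsto_const inverse_qfac_shift_tendsto)
  have w: "norm (theta_weight j) \<le> 2" for j
  proof -
    have "norm (q ^ i) \<le> 1" for i using norm_q by (simp add: norm_power power_le_one)
    then have "norm (q ^ i + q ^ k) \<le> 2" for i k
      using norm_triangle_ineq[of "q ^ i" "q ^ k"] by (smt (verit))
    then show ?thesis by (simp add: theta_weight_def norm_mult norm_power)
  qed
  have b_bound: "norm (b j n) \<le> 2 * (C * C) * norm q ^ j" for j n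
  proof -
    have "j \<le> 2 * j\<^sup>2" by (simp add: power2_eq_square)
    then have "norm (q ^ (2 * j\<^sup>2)) * norm (theta_weight j) * norm (1 / qfac q (n - j) * (1 / qfac q (n + j)))
        \<le> norm q ^ j * 2 * (C * C)"
      using norm_q by (intro mult_mono CC norm_power_add_le w) auto
    then show ?thesis by (simp only: b_def norm_mult mult_ac)
  qed
  note B = tannery_partial_sums[OF b_lim b_bound geo]
  have eq: "(\<Sum>s\<le>n. a s n) = (\<Sum>j\<le>n. b j n)" for n
    using finite_rogers_ramanujan[of n] by (simp add: a_def b_def)
  have pos: "0 \<le> C * C * norm q ^ k" "0 \<le> 2 * (C * C) * norm q ^ k" for k
    using C by simp_all
  have "suminf (\<lambda>s. q ^ s\<^sup>2 * (1 / qfac_inf * (1 / qfac q s)))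
      = suminf (\<lambda>j. q ^ (2 * j\<^sup>2) * theta_weight j * (1 / qfac_inf * (1 / qfac_inf)))"
    using A(2)[OF pos(1)] B(2)[OF pos(2)] unfolding eq by (rule LIMSEQ_unique)
  moreover have sa: "summable (\<lambda>s. norm (1 / qfac_inf * (q ^ s\<^sup>2 / qfac q s)))"
    using A(1)[OF pos(1)] by (simp add: mult_ac)
  then show sa': "summable (\<lambda>s. norm (q ^ s\<^sup>2 / qfac q s))"
    using qfac_inf_nonzero by (subst (asm) norm_mult) (simp only: summable_cmult_iff, simp)
  moreover have sb: "summable (\<lambda>j. norm (1 / qfac_inf * (1 / qfac_inf) * (q ^ (2 * j\<^sup>2) * theta_weight j)))"
    using B(1)[OF pos(2)] by (simp only: mult_ac)
  then show sb': "summable (\<lambda>j. norm (q ^ (2 * j\<^sup>2) * theta_weight j))"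
    using qfac_inf_nonzero by (subst (asm) norm_mult) (simp only: summable_cmult_iff, simp)
  ultimately have "1 / qfac_inf * (suminf (\<lambda>s. q ^ s\<^sup>2 / qfac q s))
      = 1 / qfac_inf * (1 / qfac_inf) * (suminf (\<lambda>j. q ^ (2 * j\<^sup>2) * theta_weight j))"
    using suminf_mult[OF summable_norm_cancel[OF sa'], of "1 / qfac_inf"]
      suminf_mult[OF summable_norm_cancel[OF sb'], of "1 / qfac_inf * (1 / qfac_inf)"]
    by (simp add: mult_ac)
  then show "(suminf (\<lambda>s. q ^ s\<^sup>2 / qfac q s)) = (suminf (\<lambda>j. q ^ (2 * j\<^sup>2) * theta_weight j)) / qfac_inf"
    using qfac_inf_nonzero by (simp add: field_simps)
qed

text \<open>The finite q-binomial theorem at x = q^{a+1}, with n tending to infinity. The finite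
  product is (-q)_{a+n} / (-q)_a; multiplying by (-q)_a keeps the identity free of division.\<close>

lemma euler_sum:
  "summable (\<lambda>k. norm (q ^ (k * (k - 1) div 2) * (q ^ Suc a) ^ k / qfac q k))"
  "(suminf (\<lambda>k. q ^ (k * (k - 1) div 2) * (q ^ Suc a) ^ k / qfac q k)) * qfac_plus q a = qfac_plus_inf"
proof -
  obtain C where C: "C > 0" "\<And>n. norm (1 / qfac q n) \<le> C" by (rule inverse_qfac_bound, rule that)
  obtain D where D: "D > 0" "\<And>n. norm (qfac q n) \<le> D" by (rule qfac_bound, rule that)
  define t where "t k = q ^ (k * (k - 1) div 2) * (q ^ Suc a) ^ k" for k
  have t: "norm (t k) \<le> norm q ^ k" for k
  proof -
    have "t k = q ^ (k * (k - 1) div 2 + Suc a * k)" by (simp only: t_def power_add power_mult)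
    then show ?thesis using norm_q by (simp only:) (rule norm_power_add_le; simp)
  qed
  define b where "b k n = t k * (qfac q n * (1 / qfac q (n - k)) * (1 / qfac q k))" for k n
  have "(\<lambda>n. b k n) \<longlonglongrightarrow> t k * (qfac_inf * (1 / qfac_inf) * (1 / qfac q k))" for k
    unfolding b_def by (intro tendsto_mult tendsto_const inverse_qfac_shift_tendsto qfac_tendsto)
  then have lim: "(\<lambda>n. b k n) \<longlonglongrightarrow> t k / qfac q k" for k
    using qfac_inf_nonzero by simp
  have bound: "norm (b k n) \<le> D * C * C * norm q ^ k" for k n
  proof -
    have "norm (t k) * (norm (qfac q n) * norm (1 / qfac q (n - k)) * norm (1 / qfac q k))
        \<le> norm q ^ k * (D * C * C)"
      using C D by (intro mult_mono t) auto
    then show ?thesis by (simp only: b_def norm_mult mult_ac)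
  qed
  have geo: "summable (\<lambda>k. D * C * C * norm q ^ k)"
    using norm_q by (intro summable_mult summable_geometric) simp
  have pos: "0 \<le> D * C * C * norm q ^ k" for k using C D by simp
  note A = tannery_partial_sums[OF lim bound geo pos]
  show "summable (\<lambda>k. norm (q ^ (k * (k - 1) div 2) * (q ^ Suc a) ^ k / qfac q k))"
    using A(1) by (simp only: t_def)
  have "(\<Sum>k\<le>n. b k n) * qfac_plus q a = qfac_plus q (a + n)" for n
  proof -
    have "(\<Sum>k\<le>n. b k n) = (\<Sum>k\<le>n. gauss_binomial q n k * q ^ (k * (k - 1) div 2) * (q ^ Suc a) ^ k)"
      by (intro sum.cong) (simp_all add: b_def t_def gauss_binomial_eq mult_ac)
    also have "\<dots> = (\<Prod>i<n. 1 + q ^ Suc a * q ^ i)"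
      by (rule gauss_binomial_theorem[symmetric])
    finally have "(\<Sum>k\<le>n. b k n) = (\<Prod>i<n. 1 + q ^ Suc (a + i))"
      by (simp add: power_add mult.assoc)
    moreover have "(\<Prod>i<n. 1 + q ^ Suc (a + i)) * qfac_plus q a = qfac_plus q (a + n)"
      by (induction n) (simp_all add: qfac_plus_Suc mult_ac)
    ultimately show ?thesis by simp
  qed
  then have "(\<lambda>n. qfac_plus q (a + n)) \<longlonglongrightarrow> suminf (\<lambda>k. t k / qfac q k) * qfac_plus q a"
    using tendsto_mult[OF A(2) tendsto_const[of "qfac_plus q a"]] by simp
  moreover have "(\<lambda>n. qfac_plus q (a + n)) \<longlonglongrightarrow> qfac_plus_inf"
    using LIMSEQ_ignore_initial_segment[OF qfac_plus_tendsto, of a] by (simp add: add.commute)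
  ultimately show "(suminf (\<lambda>k. q ^ (k * (k - 1) div 2) * (q ^ Suc a) ^ k / qfac q k)) * qfac_plus q a = qfac_plus_inf"
    unfolding t_def using LIMSEQ_unique by blast
qed

end

section \<open>Summation over the four indices\<close>

lemma summable_on_product_nonneg:
  fixes f :: "'a \<Rightarrow> real" and g :: "'b \<Rightarrow> real"
  assumes f: "f summable_on A" "\<And>x. x \<in> A \<Longrightarrow> 0 \<le> f x"
    and g: "g summable_on B" "\<And>y. y \<in> B \<Longrightarrow> 0 \<le> g y"
  shows "(\<lambda>(x, y). f x * g y) summable_on A \<times> B"
proof (rule summable_on_SigmaI)
  show "((\<lambda>y. case (x, y) of (x, y) \<Rightarrow> f x * g y) has_sum f x * infsum g B) B" for x
    using has_sum_cmult_right[OF has_sum_infsum[OF g(1)], of "f x"] by simp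
  show "(\<lambda>x. f x * infsum g B) summable_on A"
    by (rule summable_on_cmult_left[OF f(1)])
qed (use f g in auto)

lemma summable_on_geometric:
  fixes r :: real
  assumes "0 \<le> r" "r < 1"
  shows "(\<lambda>n::nat. r ^ n) summable_on UNIV"
  by (rule norm_summable_imp_summable_on) (use assms in \<open>simp add: summable_geometric\<close>)

text \<open>Groups the indices so that n_3 and n_4 become the inner sum.\<close>

lemma bij_nat4:
  "bij_betw (\<lambda>v :: nat^4. ((v $ 1, v $ 2), (v $ 3, v $ 4))) UNIV (UNIV \<times> UNIV)"
proof (rule bij_betw_byWitness[where f' = "\<lambda>((m, n), (k, l)). \<chi> i. if i = 1 then m else if i = 2 then n else if i = 3 then k else l"])
qed (auto simp: vec_eq_iff forall_4)

context nome
begin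

interpretation square: nome "q\<^sup>2" by (rule nome_square)

lemma qfac_plus_nonzero: "qfac_plus q n \<noteq> 0"
  using square.qfac_nonzero[of n] by (simp add: qfac_square)

lemma qfac_inf_square: "square.qfac_inf = qfac_inf * qfac_plus_inf"
proof (rule LIMSEQ_unique[OF square.qfac_tendsto])
  show "qfac (q\<^sup>2) \<longlonglongrightarrow> qfac_inf * qfac_plus_inf"
    using tendsto_mult[OF qfac_tendsto qfac_plus_tendsto] unfolding qfac_square[symmetric] .
qed

definition euler_term :: "nat \<Rightarrow> nat \<Rightarrow> complex" where
  "euler_term a k = q ^ (k * (k - 1) div 2) * (q ^ Suc a) ^ k / qfac q k"

text \<open>Completing squares: 3m^2/2 + m n + 3n^2/2 + (m - n)/2 = (m + n)^2 + T(m - n), where T is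
  \<open>tri_num\<close>. The remaining exponents go into two copies of
  \<open>euler_term\<close>.\<close>

definition pair_term :: "nat \<Rightarrow> nat \<Rightarrow> complex" where
  "pair_term m n = q ^ (m + n)\<^sup>2 * q ^ tri_num (int m - int n) / (qfac q m * qfac q n)"

lemma has_sum_euler_term: "(euler_term a has_sum qfac_plus_inf / qfac_plus q a) UNIV"
proof (rule norm_summable_imp_has_sum)
  show "summable (\<lambda>k. norm (euler_term a k))"
    unfolding euler_term_def by (rule euler_sum)
  then have "euler_term a sums suminf (euler_term a)"
    by (rule summable_sums[OF summable_norm_cancel])
  also have "suminf (euler_term a) = qfac_plus_inf / qfac_plus q a"
    using euler_sum(2)[of a] qfac_plus_nonzero[of a] by (simp add: euler_term_def[abs_def] eq_divide_eq)
  finally show "euler_term a sums (qfac_plus_inf / qfac_plus q a)" .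
qed

lemma norm_euler_term_le:
  assumes "\<And>n. norm (1 / qfac q n) \<le> C"
  shows "norm (euler_term a k) \<le> C * norm q ^ k"
proof -
  have "q ^ (k * (k - 1) div 2) * (q ^ Suc a) ^ k = q ^ (k * (k - 1) div 2 + Suc a * k)"
    by (simp only: power_add power_mult)
  then have "norm (euler_term a k) = norm (1 / qfac q k) * norm (q ^ (k * (k - 1) div 2 + Suc a * k))"
    by (simp only: euler_term_def norm_divide norm_mult norm_one) simp
  also have "\<dots> \<le> C * norm q ^ k"
    using norm_q norm_ge_zero order_trans[OF norm_ge_zero assms]
    by (intro mult_mono assms norm_power_add_le) auto
  finally show ?thesis .
qed

lemma norm_pair_term_le:
  assumes "\<And>n. norm (1 / qfac q n) \<le> C"
  shows "norm (pair_term m n) \<le> C * norm q ^ m * (C * norm q ^ n)"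
proof -
  have C: "0 \<le> C" using order_trans[OF norm_ge_zero assms] .
  have e: "m + n \<le> (m + n)\<^sup>2 + tri_num (int m - int n)"
    using self_le_power[of "m + n" 2] by (cases "m + n = 0") auto
  have "norm (pair_term m n) = norm (1 / qfac q m) * norm (1 / qfac q n)
      * norm (q ^ ((m + n)\<^sup>2 + tri_num (int m - int n)))"
    by (simp add: pair_term_def norm_divide norm_mult power_add)
  also have "\<dots> \<le> C * C * norm q ^ (m + n)"
    using norm_q C by (intro mult_mono assms norm_power_add_le e) auto
  finally show ?thesis by (simp add: power_add mult_ac)
qed

text \<open>The value comes from iterated summation; a product of geometric series supplies the
  joint summability that justifies it.\<close>

lemma has_sum_euler_pair:
  "((\<lambda>(k, l). euler_term m k * euler_term n l) has_sum
     (qfac_plus_inf / qfac_plus q m) * (qfac_plus_inf / qfac_plus q n)) (UNIV \<times> UNIV)"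
proof (rule has_sum_SigmaI)
  show "((\<lambda>l. case (k, l) of (k, l) \<Rightarrow> euler_term m k * euler_term n l) has_sum
      euler_term m k * (qfac_plus_inf / qfac_plus q n)) UNIV" for k
    using has_sum_cmult_right[OF has_sum_euler_term] by simp
  show "((\<lambda>k. euler_term m k * (qfac_plus_inf / qfac_plus q n)) has_sum
      (qfac_plus_inf / qfac_plus q m) * (qfac_plus_inf / qfac_plus q n)) UNIV"
    by (rule has_sum_cmult_left[OF has_sum_euler_term])
  obtain C where C: "C > 0" "\<And>n. norm (1 / qfac q n) \<le> C" by (rule inverse_qfac_bound, rule that)
  have geo: "(\<lambda>n. C * norm q ^ n) summable_on UNIV"
    using norm_q by (intro summable_on_cmult_right summable_on_geometric) auto
  show "(\<lambda>(k, l). euler_term m k * euler_term n l) summable_on UNIV \<times> UNIV"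
  proof (rule abs_summable_summable[OF Infinite_Sum.abs_summable_on_comparison_test'])
    show "(\<lambda>(k, l). C * norm q ^ k * (C * norm q ^ l)) summable_on UNIV \<times> UNIV"
      using C by (intro summable_on_product_nonneg geo) auto
    show "norm (case x of (k, l) \<Rightarrow> euler_term m k * euler_term n l)
        \<le> (case x of (k, l) \<Rightarrow> C * norm q ^ k * (C * norm q ^ l))" for x
    proof (cases x)
      case (Pair k l)
      show ?thesis
        unfolding Pair prod.case norm_mult
        by (intro mult_mono norm_euler_term_le C) (use C(1) in auto)
    qed
  qed
qed

text \<open>Since (q)_m (-q)_m = (q^2;q^2)_m, the denominators are q-factorials in base q^2. On the
  diagonal m + n = N they form a Gaussian binomial over (q^2;q^2)_N, and
  \<open>gauss_binomial_tri_num_sum\<close> cancels the factor (-q)_N of the latter.\<close>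

lemma has_sum_pair_term:
  "((\<lambda>(m, n). pair_term m n * ((qfac_plus_inf / qfac_plus q m) * (qfac_plus_inf / qfac_plus q n)))
     has_sum (qfac_plus_inf\<^sup>2 * (suminf (\<lambda>s. q ^ s\<^sup>2 / qfac q s)))) (UNIV \<times> UNIV)"
proof -
  define P where "P = qfac_plus_inf"
  define f where "f = (\<lambda>(m, n). pair_term m n * ((P / qfac_plus q m) * (P / qfac_plus q n)))"
  have f: "f (m, n) = P\<^sup>2 * (q ^ (m + n)\<^sup>2 * q ^ tri_num (int m - int n) / (qfac (q\<^sup>2) m * qfac (q\<^sup>2) n))"
    for m n unfolding f_def pair_term_def qfac_square by (simp add: power2_eq_square mult_ac)
  have summable: "f summable_on UNIV \<times> UNIV"
  proof -
    obtain C where C: "C > 0" "\<And>n. norm (1 / qfac (q\<^sup>2) n) \<le> C"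
      by (rule square.inverse_qfac_bound, rule that)
    have geo: "(\<lambda>n. C * norm q ^ n) summable_on UNIV"
      using norm_q by (intro summable_on_cmult_right summable_on_geometric) auto
    have bound: "norm (f (m, n)) \<le> norm (P\<^sup>2) * (C * norm q ^ m * (C * norm q ^ n))" for m n
    proof -
      have e: "m + n \<le> (m + n)\<^sup>2 + tri_num (int m - int n)"
        using self_le_power[of "m + n" 2] by (cases "m + n = 0") auto
      have "norm (f (m, n)) = norm (P\<^sup>2) * (norm (1 / qfac (q\<^sup>2) m) * norm (1 / qfac (q\<^sup>2) n)
          * norm (q ^ ((m + n)\<^sup>2 + tri_num (int m - int n))))"
        by (simp add: f norm_divide norm_mult power_add)
      also have "\<dots> \<le> norm (P\<^sup>2) * (C * C * norm q ^ (m + n))"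
        using norm_q C by (intro mult_left_mono mult_mono norm_power_add_le e) auto
      finally show ?thesis by (simp add: power_add mult_ac)
    qed
    have sum: "(\<lambda>x. norm (P\<^sup>2) * (case x of (m, n) \<Rightarrow> C * norm q ^ m * (C * norm q ^ n)))
        summable_on UNIV \<times> UNIV"
      using C by (intro summable_on_cmult_right summable_on_product_nonneg geo) auto
    show ?thesis
    proof (rule abs_summable_summable[OF Infinite_Sum.abs_summable_on_comparison_test'[OF sum]])
      show "norm (f x) \<le> norm (P\<^sup>2) * (case x of (m, n) \<Rightarrow> C * norm q ^ m * (C * norm q ^ n))" for x
        using bound by (cases x) simp
    qed
  qed
  define h where "h = (\<lambda>(N, m). f (m, N - m))"
  have bij: "(h has_sum S) (SIGMA N:UNIV. {..N}) \<longleftrightarrow> (f has_sum S) (UNIV \<times> UNIV)" for S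
    by (rule has_sum_reindex_bij_witness[of _ "\<lambda>(m, n). (m + n, m)" "\<lambda>(N, m). (m, N - m)"])
       (auto simp: h_def)
  have "(h has_sum (P\<^sup>2 * (suminf (\<lambda>s. q ^ s\<^sup>2 / qfac q s)))) (SIGMA N:UNIV. {..N})"
  proof (rule has_sum_SigmaI)
    show "h summable_on (SIGMA N:UNIV. {..N})"
      using summable bij unfolding summable_on_def by blast
    show "((\<lambda>N. P\<^sup>2 * (q ^ N\<^sup>2 / qfac q N)) has_sum (P\<^sup>2 * (suminf (\<lambda>s. q ^ s\<^sup>2 / qfac q s)))) UNIV"
      by (intro has_sum_cmult_right norm_summable_imp_has_sum rogers_ramanujan_sum(1)
          summable_sums[OF summable_norm_cancel[OF rogers_ramanujan_sum(1)]])
    show "((\<lambda>m. h (N, m)) has_sum (P\<^sup>2 * (q ^ N\<^sup>2 / qfac q N))) {..N}" for N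
    proof (rule has_sum_finiteI)
      have "(\<Sum>m\<le>N. h (N, m)) = (\<Sum>m\<le>N. P\<^sup>2 * q ^ N\<^sup>2 / qfac (q\<^sup>2) N
          * (gauss_binomial (q\<^sup>2) N m * q ^ tri_num (2 * int m - int N)))"
      proof (rule sum.cong)
        fix m assume m: "m \<in> {..N}"
        have d: "int m - int (N - m) = 2 * int m - int N" "m + (N - m) = N"
          using m by (auto simp: of_nat_diff)
        show "h (N, m) = P\<^sup>2 * q ^ N\<^sup>2 / qfac (q\<^sup>2) N
          * (gauss_binomial (q\<^sup>2) N m * q ^ tri_num (2 * int m - int N))"
          using m square.qfac_nonzero[of N] square.gauss_binomial_eq[of m N]
          by (simp add: h_def f d)
      qed simp
      also have "\<dots> = P\<^sup>2 * q ^ N\<^sup>2 / qfac (q\<^sup>2) N * qfac_plus q N"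
        unfolding sum_distrib_left[symmetric]
        by (subst gauss_binomial_tri_num_sum) (simp_all add: square.qfac_nonzero)
      also have "\<dots> = P\<^sup>2 * (q ^ N\<^sup>2 / qfac q N)"
        using qfac_plus_nonzero[of N] by (simp add: qfac_square)
      finally show "P\<^sup>2 * (q ^ N\<^sup>2 / qfac q N) = (\<Sum>m\<le>N. h (N, m))" by simp
    qed simp
  qed
  then show ?thesis unfolding bij f_def P_def .
qed

definition quad_term :: "nat^4 \<Rightarrow> complex" where
  "quad_term v = pair_term (v $ 1) (v $ 2) * (euler_term (v $ 1) (v $ 3) * euler_term (v $ 2) (v $ 4))"

lemma has_sum_quad_term:
  "(quad_term has_sum (qfac_plus_inf\<^sup>2 * (suminf (\<lambda>s. q ^ s\<^sup>2 / qfac q s)))) UNIV"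
proof -
  define t where "t = (\<lambda>((m, n), (k, l)). pair_term m n * (euler_term m k * euler_term n l))"
  have "(t has_sum (qfac_plus_inf\<^sup>2 * (suminf (\<lambda>s. q ^ s\<^sup>2 / qfac q s)))) ((UNIV \<times> UNIV) \<times> (UNIV \<times> UNIV))"
  proof (rule has_sum_SigmaI[OF _ has_sum_pair_term])
    show "((\<lambda>y. t (x, y)) has_sum (case x of (m, n) \<Rightarrow>
        pair_term m n * ((qfac_plus_inf / qfac_plus q m) * (qfac_plus_inf / qfac_plus q n)))) (UNIV \<times> UNIV)" for x
    proof (cases x)
      case (Pair m n)
      have "(\<lambda>y. t (x, y)) = (\<lambda>y. pair_term m n * (case y of (k, l) \<Rightarrow> euler_term m k * euler_term n l))"
        by (auto simp: t_def Pair)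
      then show ?thesis using has_sum_cmult_right[OF has_sum_euler_pair] by (simp add: Pair)
    qed
    obtain C where C: "C > 0" "\<And>n. norm (1 / qfac q n) \<le> C" by (rule inverse_qfac_bound, rule that)
    have geo: "(\<lambda>n. C * norm q ^ n) summable_on UNIV"
      using norm_q by (intro summable_on_cmult_right summable_on_geometric) auto
    show "t summable_on (UNIV \<times> UNIV) \<times> (UNIV \<times> UNIV)"
    proof (rule abs_summable_summable[OF Infinite_Sum.abs_summable_on_comparison_test'])
      show "(\<lambda>(x, y). (case x of (m, n) \<Rightarrow> C * norm q ^ m * (C * norm q ^ n))
          * (case y of (k, l) \<Rightarrow> C * norm q ^ k * (C * norm q ^ l)))
          summable_on (UNIV \<times> UNIV) \<times> (UNIV \<times> UNIV)"
        using C by (intro summable_on_product_nonneg geo) auto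
      show "norm (t z) \<le> (case z of (x, y) \<Rightarrow> (case x of (m, n) \<Rightarrow> C * norm q ^ m * (C * norm q ^ n))
          * (case y of (k, l) \<Rightarrow> C * norm q ^ k * (C * norm q ^ l)))" for z
      proof -
        obtain m n k l where z: "z = ((m, n), (k, l))" by (metis prod.exhaust)
        show ?thesis
          unfolding z t_def prod.case norm_mult
          by (intro mult_mono norm_euler_term_le norm_pair_term_le C) (use C(1) in auto)
      qed
    qed
  qed
  then have "((\<lambda>v :: nat^4. t ((v $ 1, v $ 2), (v $ 3, v $ 4))) has_sum
      (qfac_plus_inf\<^sup>2 * (suminf (\<lambda>s. q ^ s\<^sup>2 / qfac q s)))) UNIV"
    by (subst has_sum_reindex_bij_betw[OF bij_nat4]) simp
  then show ?thesis by (simp add: t_def quad_term_def[abs_def])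
qed

text \<open>The exponent is ((10 x + 1)^2 - 1)/40, the one in \<open>theta_5_1\<close> at n = 10 x +
  1 without the shift 1/40.\<close>

definition theta_term :: "int \<Rightarrow> complex" where
  "theta_term x = (-1) powi x * q ^ (nat (2 * x\<^sup>2) + tri_num x)"

lemma has_sum_theta_term:
  "(theta_term has_sum (suminf (\<lambda>j. q ^ (2 * j\<^sup>2) * theta_weight j))) UNIV"
proof -
  \<comment> \<open>Integers are grouped by absolute value. At j = 0 the pair collapses to one
    element, in accordance with the separate value of \<open>theta_weight\<close> at 0.\<close>
  define D where "D = (SIGMA j:UNIV. {int j, - int j})"
  have bij: "(f \<circ> snd has_sum S) D \<longleftrightarrow> (f has_sum S) UNIV" for f :: "int \<Rightarrow> 'b::{comm_monoid_add,t2_space}" and S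
    by (rule has_sum_reindex_bij_witness[of _ "\<lambda>x. (nat \<bar>x\<bar>, x)" snd]) (auto simp: D_def abs_if)
  have norm: "norm (theta_term x) \<le> norm q ^ nat \<bar>x\<bar>" for x
  proof -
    have "\<bar>x\<bar> \<le> x\<^sup>2"
    proof (cases "x = 0")
      case False
      then have "\<bar>x\<bar> * 1 \<le> \<bar>x\<bar> * \<bar>x\<bar>" by (intro mult_left_mono) auto
      then show ?thesis by (simp add: power2_eq_square)
    qed simp
    then have "nat \<bar>x\<bar> \<le> nat (2 * x\<^sup>2) + tri_num x" by linarith
    then have "norm (q ^ (nat (2 * x\<^sup>2) + tri_num x)) \<le> norm q ^ nat \<bar>x\<bar>"
      by (rule norm_power_add_le[OF norm_q])
    then show ?thesis by (simp add: theta_term_def norm_mult norm_power_int)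
  qed
  have "(theta_term \<circ> snd) summable_on D"
  proof (rule abs_summable_summable)
    show "(\<lambda>y. norm ((theta_term \<circ> snd) y)) summable_on D"
      unfolding D_def
    proof (rule summable_on_SigmaI)
      show "((\<lambda>x. norm ((theta_term \<circ> snd) (j, x))) has_sum
          (\<Sum>x\<in>{int j, - int j}. norm (theta_term x))) {int j, - int j}" for j
        by (rule has_sum_finiteI) auto
      have bound: "(\<Sum>x\<in>{int j, - int j}. norm (theta_term x)) \<le> 2 * norm q ^ j" for j
        using norm[of "int j"] norm[of "- int j"] by (cases "j = 0") auto
      have geo: "(\<lambda>j. 2 * norm q ^ j) summable_on UNIV"
        using norm_q by (intro summable_on_cmult_right summable_on_geometric) auto
      show "(\<lambda>j. \<Sum>x\<in>{int j, - int j}. norm (theta_term x)) summable_on UNIV"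
        by (rule summable_on_comparison_test[OF geo bound]) (rule sum_nonneg, rule norm_ge_zero)
    qed auto
  qed
  then have "(theta_term \<circ> snd has_sum (suminf (\<lambda>j. q ^ (2 * j\<^sup>2) * theta_weight j))) D"
    unfolding D_def
  proof (rule has_sum_SigmaI[rotated 2])
    show "((\<lambda>j. q ^ (2 * j\<^sup>2) * theta_weight j) has_sum (suminf (\<lambda>j. q ^ (2 * j\<^sup>2) * theta_weight j))) UNIV"
      by (intro norm_summable_imp_has_sum rogers_ramanujan_sum(2)
          summable_sums[OF summable_norm_cancel[OF rogers_ramanujan_sum(2)]])
    show "((\<lambda>x. (theta_term \<circ> snd) (j, x)) has_sum (q ^ (2 * j\<^sup>2) * theta_weight j)) {int j, - int j}" for j
    proof (rule has_sum_finiteI)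
      show "q ^ (2 * j\<^sup>2) * theta_weight j = (\<Sum>x\<in>{int j, - int j}. (theta_term \<circ> snd) (j, x))"
      proof (cases "j = 0")
        case True
        then show ?thesis by (simp add: theta_weight_def theta_term_def tri_num_def)
      next
        case False
        have 1: "tri_num (int j) = j * (j + 1) div 2"
        proof -
          have "int j * (int j + 1) = int (j * (j + 1))" by (simp add: algebra_simps)
          then have "int j * (int j + 1) div 2 = int (j * (j + 1) div 2)"
            by (simp only: zdiv_int of_nat_numeral)
          then show ?thesis by (simp only: tri_num_def nat_int)
        qed
        have 2: "tri_num (- int j) = j * (j - 1) div 2"
        proof -
          have "- int j * (- int j + 1) = int (j * (j - 1))"
            using False by (simp add: of_nat_diff algebra_simps)
          then have "- int j * (- int j + 1) div 2 = int (j * (j - 1) div 2)"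
            by (simp only: zdiv_int of_nat_numeral)
          then show ?thesis by (simp only: tri_num_def nat_int)
        qed
        have 3: "nat (2 * (int j)\<^sup>2) = 2 * j\<^sup>2" "nat (2 * (- int j)\<^sup>2) = 2 * j\<^sup>2"
          by (simp_all add: nat_mult_distrib nat_power_eq)
        have 4: "(-1) powi int j = (-1 :: complex) ^ j" "(-1) powi (- int j) = (-1 :: complex) ^ j"
          by (simp_all add: power_int_minus flip: power_inverse)
        have "int j \<noteq> - int j" using False by simp
        then have "(\<Sum>x\<in>{int j, - int j}. (theta_term \<circ> snd) (j, x)) = theta_term (int j) + theta_term (- int j)"
          by simp
        also have "\<dots> = q ^ (2 * j\<^sup>2) * theta_weight j"
          using False unfolding theta_term_def 1 2 3 4 theta_weight_def
          by (simp only: power_add if_False) (simp only: ring_distribs mult_ac)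
        finally show ?thesis by simp
      qed
    qed simp
  qed
  then show ?thesis unfolding bij .
qed

end

section \<open>The Nahm sum\<close>

lemma qpow_add: "qpow z (a + b) = qpow z a * qpow z b"
  by (simp add: qpow_def algebra_simps flip: exp_add)

lemma qpow_nonzero: "qpow z a \<noteq> 0"
  by (simp add: qpow_def)

lemma qpow_of_nat: "qpow z (real n) = qpow z 1 ^ n"
  by (simp add: qpow_def mult_ac flip: exp_of_nat_mult)

lemma qpow_scale: "qpow (2 * z) a = qpow z (2 * a)"
  by (simp add: qpow_def mult_ac)

lemma nome_qpow:
  assumes "Im z > 0"
  shows "nome (qpow z 1)"
  using assms by unfold_locales (simp add: qpow_def)

lemma qpoch_eq_qfac: "qpoch z n = qfac (qpow z 1) n"
  by (simp only: qpoch_def qfac_def qpow_of_nat)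

lemma dedekind_eta_eq:
  assumes "Im z > 0"
  shows "dedekind_eta z = qpow z (1 / 24) * nome.qfac_inf (qpow z 1)"
proof -
  interpret nome "qpow z 1" by (rule nome_qpow[OF assms])
  show ?thesis by (simp only: dedekind_eta_def qfac_inf_def qpow_of_nat)
qed

lemma dedekind_eta_double:
  assumes "Im z > 0"
  shows "dedekind_eta (2 * z) =
    qpow z (1 / 12) * (nome.qfac_inf (qpow z 1) * nome.qfac_plus_inf (qpow z 1))"
proof -
  interpret nome "qpow z 1" by (rule nome_qpow[OF assms])
  have "qpow (2 * z) 1 = (qpow z 1)\<^sup>2"
    using qpow_of_nat[of z 2] by (simp add: qpow_scale)
  then show ?thesis
    using assms by (simp add: dedekind_eta_eq qfac_inf_square) (simp add: qpow_scale)
qed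

lemma theta_5_1_eq:
  assumes "Im z > 0"
  shows "theta_5_1 z = qpow z (1 / 40) *
    (suminf (\<lambda>j. qpow z 1 ^ (2 * j\<^sup>2) * qfac_nonzero.theta_weight (qpow z 1) j))"
proof -
  interpret nome "qpow z 1" by (rule nome_qpow[OF assms])
  let ?f = "\<lambda>n::int. (-1) powi (n div 10) * qpow z ((real_of_int n)\<^sup>2 / 40)"
  have f: "?f (10 * x + 1) = qpow z (1 / 40) * theta_term x" for x
  proof -
    have "2 * real (tri_num x) = real_of_int (2 * int (tri_num x))" by simp
    then have tri: "2 * real (tri_num x) = real_of_int x * (real_of_int x + 1)"
      unfolding two_tri_num by simp
    have "real (nat (2 * x\<^sup>2) + tri_num x) = 2 * (real_of_int x)\<^sup>2 + real (tri_num x)"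
      by simp
    then have "(real_of_int (10 * x + 1))\<^sup>2 / 40 = 1 / 40 + real (nat (2 * x\<^sup>2) + tri_num x)"
      using tri by (simp add: power2_eq_square field_simps)
    moreover have "(10 * x + 1) div 10 = x" by simp
    ultimately show ?thesis
      by (simp only: qpow_add qpow_of_nat theta_term_def) (simp only: mult_ac)
  qed
  have "theta_5_1 z = (\<Sum>\<^sub>\<infinity>x. qpow z (1 / 40) * theta_term x)"
    unfolding theta_5_1_def
  proof (rule infsum_reindex_bij_witness[of _ "\<lambda>x. 10 * x + 1" "\<lambda>n. n div 10"])
    fix n :: int assume "n \<in> {n. n mod 10 = 1}"
    then have n: "10 * (n div 10) + 1 = n"
      using mult_div_mod_eq[of 10 n] by simp
    then show "10 * (n div 10) + 1 = n" .
    show "qpow z (1 / 40) * theta_term (n div 10) = ?f n"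
      using f[of "n div 10"] unfolding n by simp
  qed (auto simp: mod_mult_self4)
  also have "\<dots> = qpow z (1 / 40) * (\<Sum>\<^sub>\<infinity>x. theta_term x)"
    by (rule infsum_cmult_right')
  also have "(\<Sum>\<^sub>\<infinity>x. theta_term x) = (suminf (\<lambda>j. qpow z 1 ^ (2 * j\<^sup>2) * theta_weight j))"
    by (rule infsumI[OF has_sum_theta_term])
  finally show ?thesis .
qed

lemma real_choose_two: "2 * real (k * (k - 1) div 2) = real k * (real k - 1)"
proof -
  have "even (k * (k - 1))" by (cases k) auto
  then have "2 * (k * (k - 1) div 2) = k * (k - 1)" by (rule dvd_mult_div_cancel)
  then have "2 * real (k * (k - 1) div 2) = real (k * (k - 1))" by (metis of_nat_mult of_nat_numeral)
  then show ?thesis by (cases k) (simp_all add: algebra_simps)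
qed

lemma nahm_term_eq_quad_term:
  fixes A :: "int^4^4" and B :: "real^4" and n :: "nat^4"
  assumes A: "A = vector [vector [3, 1, 1, 0], vector [1, 3, 0, 1],
                          vector [1, 0, 1, 0], vector [0, 1, 0, 1]]"
    and B: "B = (1/2) *\<^sub>R vector [1, -1, 1, 1]"
    and z: "Im z > 0"
  shows "nahm_term (\<chi> i j. real_of_int (A $ i $ j)) B C z n = qpow z C * nome.quad_term (qpow z 1) n"
proof -
  interpret nome "qpow z 1" by (rule nome_qpow[OF z])
  define a b c d where "a = n $ 1" and "b = n $ 2" and "c = n $ 3" and "d = n $ 4"
  define v :: "real^4" where "v = (\<chi> i. real (n $ i))"
  have v: "v $ 1 = real a" "v $ 2 = real b" "v $ 3 = real c" "v $ 4 = real d"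
    by (simp_all add: v_def a_def b_def c_def d_def)
  \<comment> \<open>The total exponent apart from \<open>C\<close>, as a natural number assembled
    from the factors of \<open>quad_term\<close>.\<close>
  define e where "e = (a + b)\<^sup>2 + tri_num (int a - int b)
    + ((c * (c - 1) div 2 + Suc a * c) + (d * (d - 1) div 2 + Suc b * d))"
  have distinct: "(1::4) \<noteq> 2" "(1::4) \<noteq> 3" "(1::4) \<noteq> 4" "(2::4) \<noteq> 3" "(2::4) \<noteq> 4" "(3::4) \<noteq> 4"
    by simp_all
  have prod: "(\<Prod>i\<in>UNIV. qpoch z (n $ i))
      = qfac (qpow z 1) a * qfac (qpow z 1) b * (qfac (qpow z 1) c * qfac (qpow z 1) d)"
    unfolding UNIV_4 qpoch_eq_qfac using distinct by (simp add: a_def b_def c_def d_def mult.assoc)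
  have quad: "v \<bullet> ((\<chi> i j. real_of_int (A $ i $ j)) *v v) =
      real a * (3 * real a + real b + real c) + real b * (real a + 3 * real b + real d)
      + real c * (real a + real c) + real d * (real b + real d)"
    unfolding inner_vec_def matrix_vector_mult_def sum_4 A vec_lambda_beta vector_4 v
    by simp
  have lin: "v \<bullet> B = (real a - real b + real c + real d) / 2"
    unfolding inner_vec_def sum_4 B vector_scaleR_component vector_4 v
    by (simp add: field_simps)
  have "2 * real (tri_num (int a - int b)) = real_of_int (2 * int (tri_num (int a - int b)))" by simp
  then have tri: "2 * real (tri_num (int a - int b)) = (real a - real b) * (real a - real b + 1)"
    unfolding two_tri_num by simp
  have "real e = (real a + real b)\<^sup>2 + real (tri_num (int a - int b))
      + ((real (c * (c - 1) div 2) + (1 + real a) * real c) + (real (d * (d - 1) div 2) + (1 + real b) * real d))"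
    unfolding e_def of_nat_add of_nat_mult of_nat_power of_nat_Suc by simp
  then have "2 * real e = 2 * ((real a + real b)\<^sup>2) + (real a - real b) * (real a - real b + 1)
      + ((real c * (real c - 1) + 2 * ((1 + real a) * real c)) + (real d * (real d - 1) + 2 * ((1 + real b) * real d)))"
    using tri real_choose_two[of c] real_choose_two[of d] by linarith
  then have "(1/2) * (v \<bullet> ((\<chi> i j. real_of_int (A $ i $ j)) *v v)) + v \<bullet> B + C = C + real e"
    unfolding quad lin by (simp add: power2_eq_square field_simps)
  then have "nahm_term (\<chi> i j. real_of_int (A $ i $ j)) B C z n = qpow z C * (qpow z 1 ^ e
      / (qfac (qpow z 1) a * qfac (qpow z 1) b * (qfac (qpow z 1) c * qfac (qpow z 1) d)))"
    unfolding nahm_term_def Let_def v_def[symmetric] prod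
    by (simp only: qpow_add qpow_of_nat times_divide_eq_right)
  also have "qpow z 1 ^ e / (qfac (qpow z 1) a * qfac (qpow z 1) b * (qfac (qpow z 1) c * qfac (qpow z 1) d))
      = quad_term n"
    unfolding quad_term_def pair_term_def euler_term_def e_def a_def[symmetric] b_def[symmetric]
      c_def[symmetric] d_def[symmetric] power_add power_mult
    by simp
  finally show ?thesis .
qed

lemma nahm_has_sum:
  fixes A :: "int^4^4" and B :: "real^4"
  assumes A: "A = vector [vector [3, 1, 1, 0], vector [1, 3, 0, 1],
                          vector [1, 0, 1, 0], vector [0, 1, 0, 1]]"
    and B: "B = (1/2) *\<^sub>R vector [1, -1, 1, 1]"
    and C: "C = 1/15"
    and z: "Im z > 0"
  shows "(nahm_term (\<chi> i j. real_of_int (A $ i $ j)) B C z has_sum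
    dedekind_eta (2 * z) ^ 2 * theta_5_1 z / dedekind_eta z ^ 3) UNIV"
proof -
  interpret nome "qpow z 1" by (rule nome_qpow[OF z])
  define \<Theta> where "\<Theta> = (suminf (\<lambda>j. qpow z 1 ^ (2 * j\<^sup>2) * theta_weight j))"
  have "(quad_term has_sum (qfac_plus_inf\<^sup>2 * (\<Theta> / qfac_inf))) UNIV"
    using has_sum_quad_term unfolding rogers_ramanujan_sum(3) \<Theta>_def .
  then have "((\<lambda>n. qpow z C * quad_term n) has_sum (qpow z C * (qfac_plus_inf\<^sup>2 * (\<Theta> / qfac_inf)))) UNIV"
    by (rule has_sum_cmult_right)
  moreover have "qpow z C * (qfac_plus_inf\<^sup>2 * (\<Theta> / qfac_inf))
      = dedekind_eta (2 * z) ^ 2 * theta_5_1 z / dedekind_eta z ^ 3"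
  proof -
    \<comment> \<open>Origin of the constant: 1/15 balances the leading exponents, 3/24 from
      eta(z)^3 against 2/12 from eta(2z)^2 and 1/40 from the theta series.\<close>
    have "C + (1 / 24 + 1 / 24 + 1 / 24) = 1 / 12 + 1 / 12 + 1 / (40 :: real)" by (simp add: C)
    then have "qpow z C * (qpow z (1 / 24) * qpow z (1 / 24) * qpow z (1 / 24))
        = qpow z (1 / 12) * qpow z (1 / 12) * qpow z (1 / 40)"
      by (simp only: flip: qpow_add)
    then have e: "qpow z C * qpow z (1 / 24) ^ 3 = qpow z (1 / 12) ^ 2 * qpow z (1 / 40)"
      by (simp add: power3_eq_cube power2_eq_square mult.assoc)
    have "qpow z C * (qfac_plus_inf\<^sup>2 * (\<Theta> / qfac_inf)) * (qpow z (1 / 24) * qfac_inf) ^ 3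
        = (qpow z C * qpow z (1 / 24) ^ 3) * (qfac_inf * qfac_plus_inf) ^ 2 * \<Theta>"
      using qfac_inf_nonzero by (simp add: power_mult_distrib power3_eq_cube power2_eq_square mult_ac)
    also have "\<dots> = (qpow z (1 / 12) * (qfac_inf * qfac_plus_inf)) ^ 2 * (qpow z (1 / 40) * \<Theta>)"
      unfolding e by (simp add: power_mult_distrib mult_ac)
    finally show ?thesis
      unfolding dedekind_eta_eq[OF z] dedekind_eta_double[OF z] theta_5_1_eq[OF z] \<Theta>_def[symmetric]
      using qfac_inf_nonzero by (simp only: eq_divide_eq) (simp add: qpow_nonzero)
  qed
  ultimately show ?thesis
    unfolding nahm_term_eq_quad_term[OF A B z, abs_def] by simp
qed

theorem mainTheorem4:
  fixes A :: "int^4^4" and B :: "real^4" and C :: real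
    and sol1 sol2 :: "complex \<Rightarrow> complex^4"
  assumes A: "A = vector [vector [3, 1, 1, 0],
                          vector [1, 3, 0, 1],
                          vector [1, 0, 1, 0],
                          vector [0, 1, 0, 1]]"
    and B: "B = (1/2) *\<^sub>R vector [1, -1, 1, 1]"
    and C: "C = 1/15"
    and sol1: "\<And>u. sol1 u = vector [u, u, 1 / (1 + u), 1 / (1 + u)]"
    and sol2: "\<And>u. sol2 u = vector [u, -u, 1 / (1 + u), 1 / (1 - u)]"
  shows
    "(\<forall>z. Im z > 0 \<longrightarrow>
        nahm_term (\<chi> i j. real_of_int (A $ i $ j)) B C z summable_on UNIV \<and>
        nahm_sum (\<chi> i j. real_of_int (A $ i $ j)) B C z =
          dedekind_eta (2 * z) ^ 2 * theta_5_1 z / dedekind_eta z ^ 3)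
     \<and>
     {Q. (\<forall>i. Q $ i \<noteq> 0) \<and> nahm_system A Q} =
       {sol1 u | u. 1 - u ^ 2 = u ^ 4} \<union> {sol2 u | u. 1 - u ^ 2 = - (u ^ 4)}
     \<and>
     (\<forall>u. 1 - u ^ 2 = u ^ 4 \<longrightarrow>
        bloch_class (sol1 u) \<in> torsion_elements (bloch_group (coordinate_field (sol1 u))))
     \<and>
     (\<forall>u. 1 - u ^ 2 = - (u ^ 4) \<longrightarrow>
        bloch_class (sol2 u) \<in> carrier (bloch_group (coordinate_field (sol2 u)))
          - torsion_elements (bloch_group (coordinate_field (sol2 u))))"
proof (intro conjI allI impI)
  fix z :: complex assume z: "Im z > 0"
  note sum = nahm_has_sum[OF A B C z]
  show "nahm_term (\<chi> i j. real_of_int (A $ i $ j)) B C z summable_on UNIV"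
    using sum by (rule has_sum_imp_summable)
  show "nahm_sum (\<chi> i j. real_of_int (A $ i $ j)) B C z =
      dedekind_eta (2 * z) ^ 2 * theta_5_1 z / dedekind_eta z ^ 3"
    unfolding nahm_sum_def using sum by (rule infsumI)
next
  have eq1: "Q = sol1 u \<longleftrightarrow> Q $ 1 = u \<and> Q $ 2 = u \<and> Q $ 3 = 1 / (1 + u) \<and> Q $ 4 = 1 / (1 + u)" for Q u
    by (simp only: vec_eq_iff forall_4 sol1 vector_4)
  have eq2: "Q = sol2 u \<longleftrightarrow> Q $ 1 = u \<and> Q $ 2 = - u \<and> Q $ 3 = 1 / (1 + u) \<and> Q $ 4 = 1 / (1 - u)" for Q u
    by (simp only: vec_eq_iff forall_4 sol2 vector_4)
  have "(\<forall>i. Q $ i \<noteq> 0) \<and> nahm_system A Q \<longleftrightarrow>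
      (\<exists>u. Q = sol1 u \<and> 1 - u ^ 2 = u ^ 4) \<or> (\<exists>u. Q = sol2 u \<and> 1 - u ^ 2 = - (u ^ 4))" for Q
  proof -
    have "(\<forall>i. Q $ i \<noteq> 0) \<and> nahm_system A Q \<longleftrightarrow> Q $ 3 = 1 / (1 + Q $ 1) \<and> Q $ 4 = 1 / (1 + Q $ 2) \<and>
      (Q $ 2 = Q $ 1 \<and> 1 - (Q $ 1) ^ 2 = (Q $ 1) ^ 4 \<or> Q $ 2 = - Q $ 1 \<and> 1 - (Q $ 1) ^ 2 = - ((Q $ 1) ^ 4))"
      unfolding nahm_system_4_iff[OF A] forall_4 conj_assoc by (rule nahm_solutions)
    then show ?thesis unfolding eq1 eq2 by auto
  qed
  then show "{Q. (\<forall>i. Q $ i \<noteq> 0) \<and> nahm_system A Q} =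
      {sol1 u | u. 1 - u ^ 2 = u ^ 4} \<union> {sol2 u | u. 1 - u ^ 2 = - (u ^ 4)}"
    by (auto simp del: not_ex)
next
  fix u :: complex
  show "bloch_class (sol1 u) \<in> torsion_elements (bloch_group (coordinate_field (sol1 u)))"
    if "1 - u ^ 2 = u ^ 4"
    unfolding sol1 using that by (rule bloch_class_first_type)
  show "bloch_class (sol2 u) \<in> carrier (bloch_group (coordinate_field (sol2 u)))
      - torsion_elements (bloch_group (coordinate_field (sol2 u)))"
    if "1 - u ^ 2 = - (u ^ 4)"
    unfolding sol2 using that by (rule bloch_class_second_type)
qed

end
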